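(* Let $M$ be a von Neumann algebra acting on a Hilbert space $H$, and let $a, b \in [0,1]_M$ be strict elements of $M$ such that $a$ is absolutely compatible with $b$. Put $p = 1 - r(a \circ b)$, where $a\circ b = \frac{1}{2}(ab+ba)$ and $r(x)$ denotes the range projection of $x$. Then: (1) $pH$ is isometrically isomorphic to $(1-p)H$; in particular $H \equiv K \oplus K$, where $K = pH$. (2) There exist elements $a_1, b_1 \in [0,p]\cap M$ which are strict in $pMp$, with $a_1 b_1 = b_1 a_1$, $a_1 + b_1 \le p$, and $p - (a_1+b_1)$ strict in $pMp$, together with a unitary $U : H \to K \oplus K$ such that $$a = U^* \begin{bmatrix} a_1 & (a_1 b_1)^{\frac{1}{2}} \\ (a_1 b_1)^{\frac{1}{2}} & p - a_1 \end{bmatrix} U \quad\text{and}\quad b = U^* \begin{bmatrix} b_1 & - (a_1 b_1)^{\frac{1}{2}} \\ - (a_1 b_1)^{\frac{1}{2}} & p - b_1 \end{bmatrix} U.$$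
   Context: For a von Neumann algebra $N$ with unit $1_N$, $[0,1]_N = \{x \in N : 0 \le x \le 1_N\}$, and $\mathcal{P}(N)$ is the set of projections of $N$. For $x \in [0,1]_N$ define $s(x) = \sup\{q \in \mathcal{P}(N) : q \le x\}$ and $n(x) = \sup\{q \in \mathcal{P}(N) : qx = 0\}$; $x$ is called strict in $N$ if $s(x) = 0$ and $n(x) = 0$. For a projection $p\in M$, strictness in $pMp$ refers to the von Neumann algebra $pMp$ with unit $p$ (so for $x\in[0,p]\cap M$ the suprema are over projections of $pMp$). Two elements $a, b \in [0,1]_M$ are absolutely compatible if $|a-b| + |1 - a - b| = 1$, where $|x| = (x^*x)^{1/2}$. $r(x)$ is the range projection of $x$. *)

theory Defs
  imports "HOL-Analysis.Analysis"
begin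

class chilbert = real_normed_vector + complete_space +
  fixes cscale :: "complex \<Rightarrow> 'a \<Rightarrow> 'a"
    and cinner :: "'a \<Rightarrow> 'a \<Rightarrow> complex"
  assumes cscale_of_real: "cscale (of_real r) x = scaleR r x"
    and cscale_add_left: "cscale (c + d) x = cscale c x + cscale d x"
    and cscale_add_right: "cscale c (x + y) = cscale c x + cscale c y"
    and cscale_assoc: "cscale c (cscale d x) = cscale (c * d) x"
    and cinner_add_right: "cinner x (y + z) = cinner x y + cinner x z"
    and cinner_scale_right: "cinner x (cscale c y) = c * cinner x y"
    and cinner_commute: "cinner y x = cnj (cinner x y)"
    and cinner_norm: "norm x = sqrt (Re (cinner x x))"

definition clinear_map :: "('a::chilbert \<Rightarrow> 'b::chilbert) \<Rightarrow> bool" where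
  "clinear_map A \<longleftrightarrow> (\<forall>x y. A (x + y) = A x + A y) \<and> (\<forall>c x. A (cscale c x) = cscale c (A x))"

definition bop :: "('a::chilbert \<Rightarrow> 'a) \<Rightarrow> bool" where
  "bop A \<longleftrightarrow> clinear_map A \<and> (\<exists>K. \<forall>x. norm (A x) \<le> K * norm x)"

definition zero_op :: "'a::chilbert \<Rightarrow> 'a" where "zero_op = (\<lambda>_. 0)"

definition adj :: "('a::chilbert \<Rightarrow> 'a) \<Rightarrow> ('a \<Rightarrow> 'a)" where
  "adj A = (THE B. \<forall>x y. cinner (A x) y = cinner x (B y))"

definition opos :: "('a::chilbert \<Rightarrow> 'a) \<Rightarrow> bool" where
  "opos A \<longleftrightarrow> bop A \<and> (\<forall>x. Im (cinner x (A x)) = 0 \<and> Re (cinner x (A x)) \<ge> 0)"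

definition ole :: "('a::chilbert \<Rightarrow> 'a) \<Rightarrow> ('a \<Rightarrow> 'a) \<Rightarrow> bool" where
  "ole A B \<longleftrightarrow> bop A \<and> bop B \<and> opos (\<lambda>x. B x - A x)"

definition osqrt :: "('a::chilbert \<Rightarrow> 'a) \<Rightarrow> ('a \<Rightarrow> 'a)" where
  "osqrt A = (THE S. opos S \<and> S \<circ> S = A)"

definition oabs :: "('a::chilbert \<Rightarrow> 'a) \<Rightarrow> ('a \<Rightarrow> 'a)" where
  "oabs A = osqrt (adj A \<circ> A)"

definition is_proj :: "('a::chilbert \<Rightarrow> 'a) \<Rightarrow> bool" where
  "is_proj P \<longleftrightarrow> bop P \<and> P \<circ> P = P \<and> adj P = P"

definition rproj :: "('a::chilbert \<Rightarrow> 'a) \<Rightarrow> ('a \<Rightarrow> 'a)" where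
  "rproj A = (THE P. is_proj P \<and> range P = closure (range A))"

definition commutant :: "('a::chilbert \<Rightarrow> 'a) set \<Rightarrow> ('a \<Rightarrow> 'a) set" where
  "commutant S = {B. bop B \<and> (\<forall>A\<in>S. A \<circ> B = B \<circ> A)}"

definition vna :: "('a::chilbert \<Rightarrow> 'a) set \<Rightarrow> bool" where
  "vna M \<longleftrightarrow> M \<subseteq> Collect bop \<and> id \<in> M \<and> (\<forall>A\<in>M. adj A \<in> M)
     \<and> commutant (commutant M) = M"

definition projs :: "('a::chilbert \<Rightarrow> 'a) set \<Rightarrow> ('a \<Rightarrow> 'a) set" where
  "projs N = {q \<in> N. is_proj q}"

definition psup :: "('a::chilbert \<Rightarrow> 'a) set \<Rightarrow> ('a \<Rightarrow> 'a) set \<Rightarrow> ('a \<Rightarrow> 'a)" where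
  "psup N S = (THE q. q \<in> projs N \<and> (\<forall>s\<in>S. ole s q)
      \<and> (\<forall>q'\<in>projs N. (\<forall>s\<in>S. ole s q') \<longrightarrow> ole q q'))"

definition s_proj :: "('a::chilbert \<Rightarrow> 'a) set \<Rightarrow> ('a \<Rightarrow> 'a) \<Rightarrow> ('a \<Rightarrow> 'a)" where
  "s_proj N x = psup N {q \<in> projs N. ole q x}"

definition n_proj :: "('a::chilbert \<Rightarrow> 'a) set \<Rightarrow> ('a \<Rightarrow> 'a) \<Rightarrow> ('a \<Rightarrow> 'a)" where
  "n_proj N x = psup N {q \<in> projs N. q \<circ> x = zero_op}"

definition strict_in :: "('a::chilbert \<Rightarrow> 'a) set \<Rightarrow> ('a \<Rightarrow> 'a) \<Rightarrow> bool" where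
  "strict_in N x \<longleftrightarrow> s_proj N x = zero_op \<and> n_proj N x = zero_op"

definition op_interval :: "('a::chilbert \<Rightarrow> 'a) set \<Rightarrow> ('a \<Rightarrow> 'a) \<Rightarrow> ('a \<Rightarrow> 'a) set" where
  "op_interval M u = {x \<in> M. ole zero_op x \<and> ole x u}"

definition corner :: "('a::chilbert \<Rightarrow> 'a) set \<Rightarrow> ('a \<Rightarrow> 'a) \<Rightarrow> ('a \<Rightarrow> 'a) set" where
  "corner M p = {(\<lambda>h. p (m (p h))) | m. m \<in> M}"

definition abs_compat :: "('a::chilbert \<Rightarrow> 'a) \<Rightarrow> ('a \<Rightarrow> 'a) \<Rightarrow> bool" where
  "abs_compat a b \<longleftrightarrow>
     (\<lambda>h. oabs (\<lambda>k. a k - b k) h + oabs (\<lambda>k. k - a k - b k) h) = id"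

definition jordan :: "('a::chilbert \<Rightarrow> 'a) \<Rightarrow> ('a \<Rightarrow> 'a) \<Rightarrow> ('a \<Rightarrow> 'a)" where
  "jordan a b = (\<lambda>h. scaleR (1/2) (a (b h) + b (a h)))"

section \<open>K \<oplus> K for a closed subspace K = pH, realised as pairs in pH \<times> pH\<close>

definition kk_unitary :: "('a::chilbert \<Rightarrow> 'a) \<Rightarrow> ('a \<Rightarrow> 'a \<times> 'a) \<Rightarrow> bool" where
  "kk_unitary p U \<longleftrightarrow>
     bij_betw U UNIV (range p \<times> range p)
     \<and> (\<forall>x y. U (x + y) = U x + U y)
     \<and> (\<forall>c x. U (cscale c x) = (cscale c (fst (U x)), cscale c (snd (U x))))
     \<and> (\<forall>x y. cinner (fst (U x)) (fst (U y)) + cinner (snd (U x)) (snd (U y)) = cinner x y)"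

definition mat2 :: "('a::chilbert \<Rightarrow> 'a) \<Rightarrow> ('a \<Rightarrow> 'a) \<Rightarrow> ('a \<Rightarrow> 'a) \<Rightarrow> ('a \<Rightarrow> 'a)
    \<Rightarrow> ('a \<times> 'a \<Rightarrow> 'a \<times> 'a)" where
  "mat2 A B C D = (\<lambda>(x, y). (A x + B y, C x + D y))"

end

theory Submission
  imports Defs
begin

text \<open>
  Put \<open>x = a - b\<close>, \<open>y = 1 - a - b\<close> and \<open>T = \<bar>x\<bar>\<close>. Absolute compatibility says \<open>\<bar>y\<bar> = 1 - T\<close>;
  squaring gives \<open>T = a + b - (a b + b a)\<close>. As \<open>T\<close> commutes with \<open>x\<close> and \<open>1 - T\<close> with \<open>y\<close>,
  \<open>T\<close> commutes with \<open>a\<close> and \<open>b\<close>, and \<open>j = a \<circ> b\<close> satisfies \<open>j\<^sup>2 = (1 - T) j\<close>. So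
  \<open>a + b\<close> equals \<open>T\<close> on \<open>p H = ker j\<close> and \<open>2 - T\<close> on \<open>(1 - p) H\<close>. With \<open>a\<^sub>1 = p a p\<close> and
  \<open>b\<^sub>1 = p b p\<close> it follows that \<open>a\<^sub>1 + b\<^sub>1 = T p\<close> and that the corner \<open>d = p a (1 - p)\<close> satisfies
  \<open>d d\<^sup>* = a\<^sub>1 b\<^sub>1\<close>. Strictness of \<open>a\<close> and \<open>b\<close> (trivial kernels of \<open>a\<close>, \<open>1 - a\<close>, \<open>b\<close>,
  \<open>1 - b\<close>) makes \<open>d\<close> and \<open>d\<^sup>*\<close> injective between \<open>p H\<close> and \<open>(1 - p) H\<close>, so the polar
  decomposition of \<open>d\<close> provides the unitary.
\<close>

section \<open>Complex inner product spaces and bounded operators\<close>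

text \<open>The algebra \<open>M\<close> matters at the two ends: \<open>1 - r(a)\<close> and
  \<open>1 - r(1 - a)\<close> lie in \<open>M\<close>, which turns strictness into statements about
  kernels, and \<open>p\<close> lies in \<open>M\<close>, which keeps the compressions there. In
  between there are only operator identities on the Hilbert space. The projection \<open>p\<close>
  commutes with \<open>T\<close> and with \<open>a + b\<close>, but in general not with
  \<open>a\<close> or \<open>b\<close>; hence the 2x2 matrices. The relation for \<open>j\<close>
  comes from \<open>S = a + b\<close>: since \<open>T^2 = (a - b)^2\<close>, one has
  \<open>S^2 - T^2 = 2 (S - T)\<close>. The lower right entry of \<open>a\<close> takes the form
  \<open>p - a1\<close> only after transport to \<open>pH\<close>. The identity
  \<open>(1 - p) a^2 p = (1 - p) a p\<close> says that this entry sends \<open>D h\<close> to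
  \<open>D (1 - a1) h\<close> for \<open>D = (1 - p) a p\<close>. In the polar decomposition of
  \<open>D\<close> the modulus is the root of \<open>a1 b1\<close>, which commutes with
  \<open>a1\<close> and has dense range in \<open>pH\<close>, so it can be cancelled. Roots and
  moduli are definite descriptions and have to be constructed. The binomial series does this without
  spectral theory, and commutation relations pass through it term by term.\<close>

instance chilbert \<subseteq> banach ..

lemma cinner_add_left: "cinner (x + y) z = cinner x z + cinner y z"
  for x y z :: "'a::chilbert"
  by (metis cinner_add_right cinner_commute complex_cnj_add)

lemma cinner_scale_left: "cinner (cscale c x) y = cnj c * cinner x y"
  for x y :: "'a::chilbert"
  by (metis cinner_commute cinner_scale_right complex_cnj_mult)

lemma cinner_scaleR_right: "cinner x (scaleR r y) = of_real r * cinner x y"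
  for x y :: "'a::chilbert"
  by (metis cinner_scale_right cscale_of_real)

lemma cinner_scaleR_left: "cinner (scaleR r x) y = of_real r * cinner x y"
  for x y :: "'a::chilbert"
  by (metis cinner_scale_left cscale_of_real complex_cnj_complex_of_real)

lemma cinner_zero_right [simp]: "cinner x 0 = 0" for x :: "'a::chilbert"
  using cinner_scaleR_right[of x 0 0] by simp

lemma cinner_zero_left [simp]: "cinner 0 x = 0" for x :: "'a::chilbert"
  using cinner_scaleR_left[of 0 0 x] by simp

lemma cinner_minus_right: "cinner x (- y) = - cinner x y" for x y :: "'a::chilbert"
  using cinner_scaleR_right[of x "-1" y] by simp

lemma cinner_minus_left: "cinner (- x) y = - cinner x y" for x y :: "'a::chilbert"
  using cinner_scaleR_left[of "-1" x y] by simp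

lemma cinner_diff_right: "cinner x (y - z) = cinner x y - cinner x z" for x y z :: "'a::chilbert"
  by (metis add_uminus_conv_diff cinner_add_right cinner_minus_right)

lemma cinner_diff_left: "cinner (x - y) z = cinner x z - cinner y z" for x y z :: "'a::chilbert"
  by (metis add_uminus_conv_diff cinner_add_left cinner_minus_left)

lemmas cinner_simps = cinner_add_left cinner_add_right cinner_diff_left cinner_diff_right
  cinner_minus_left cinner_minus_right cinner_scale_left cinner_scale_right
  cinner_scaleR_left cinner_scaleR_right

lemma cinner_self: "cinner x x = complex_of_real ((norm x)\<^sup>2)" for x :: "'a::chilbert"
proof (rule complex_eqI)
  have "0 \<le> sqrt (Re (cinner x x))" by (metis cinner_norm norm_ge_zero)
  then show "Re (cinner x x) = Re (complex_of_real ((norm x)\<^sup>2))" by (simp add: cinner_norm)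
  show "Im (cinner x x) = Im (complex_of_real ((norm x)\<^sup>2))"
    using arg_cong[OF cinner_commute[of x x], of Im] by simp
qed

lemma cinner_self_eq_0 [simp]: "cinner x x = 0 \<longleftrightarrow> x = 0" for x :: "'a::chilbert"
  by (simp add: cinner_self del: of_real_power)

lemma cinner_ext: "(\<And>z. cinner z x = cinner z y) \<Longrightarrow> x = y" for x y :: "'a::chilbert"
  using cinner_self_eq_0[of "x - y"] by (simp add: cinner_diff_right)

lemma cscale_simps [simp]: "cscale 1 x = x" "cscale 0 x = 0" "cscale c 0 = 0"
  "cscale (-1) x = - x"  for x :: "'a::chilbert"
  using cscale_of_real[of 1 x] cscale_of_real[of 0 x] cscale_of_real[of "-1" x]
    cscale_add_right[of c 0 0] by simp_all

lemma cscale_minus_right: "cscale c (- x) = - cscale c x" for x :: "'a::chilbert"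
  by (metis add_eq_0_iff cscale_add_right cscale_simps(3))

lemma cscale_diff_right: "cscale c (x - y) = cscale c x - cscale c y" for x y :: "'a::chilbert"
  by (metis add_uminus_conv_diff cscale_add_right cscale_minus_right)

lemma cscale_scaleR: "cscale c (scaleR r x) = scaleR r (cscale c x)" for x :: "'a::chilbert"
  by (simp add: cscale_of_real[symmetric] cscale_assoc mult.commute)

lemma norm_cscale: "norm (cscale c x) = cmod c * norm x" for x :: "'a::chilbert"
proof -
  have "complex_of_real ((norm (cscale c x))\<^sup>2) = complex_of_real ((cmod c * norm x)\<^sup>2)"
    unfolding cinner_self[symmetric] cinner_simps power_mult_distrib of_real_mult complex_norm_square[of c]
    by (simp only: cinner_self mult_ac)
  then have "(norm (cscale c x))\<^sup>2 = (cmod c * norm x)\<^sup>2" by (simp only: of_real_eq_iff)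
  then show ?thesis by (simp add: power2_eq_iff_nonneg)
qed

lemma clinear_mapD:
  assumes "clinear_map A"
  shows "A (x + y) = A x + A y" "A (cscale c x) = cscale c (A x)" "A (scaleR r x) = scaleR r (A x)"
    "A 0 = 0" "A (- x) = - A x" "A (x - y) = A x - A y"
proof -
  show add: "A (x + y) = A x + A y" for x y using assms by (simp add: clinear_map_def)
  show sc: "A (cscale c x) = cscale c (A x)" for c x using assms by (simp add: clinear_map_def)
  show "A (scaleR r x) = scaleR r (A x)" by (metis sc cscale_of_real)
  show "A 0 = 0" using sc[of 0 0] by simp
  show m: "A (- x) = - A x" for x using sc[of "-1" x] by simp
  show "A (x - y) = A x - A y" using add[of x "- y"] m by simp
qed

lemma bop_clinear: "bop A \<Longrightarrow> clinear_map A" by (simp add: bop_def)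

lemmas bopD = clinear_mapD[OF bop_clinear]

lemma bop_bounded_linear: assumes "bop A" shows "bounded_linear A"
proof -
  obtain K where K: "\<And>x. norm (A x) \<le> K * norm x" using assms unfolding bop_def by blast
  show ?thesis
    by (rule bounded_linear_intro[where K = K])
      (use K in \<open>simp_all add: bopD[OF assms] mult.commute\<close>)
qed

lemma bopI:
  assumes "bounded_linear A" "\<And>c x. A (cscale c x) = cscale c (A x)"
  shows "bop A"
proof -
  obtain K where "\<And>x. norm (A x) \<le> norm x * K" using bounded_linear.bounded[OF assms(1)] by blast
  then show ?thesis using assms(2) linear_add[OF bounded_linear.linear[OF assms(1)]]
    unfolding bop_def clinear_map_def by (metis mult.commute)
qed

lemma bop_id: "bop (\<lambda>x. x)"
  by (rule bopI) simp_all

lemma bop_zero: "bop (\<lambda>_. 0)"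
  by (rule bopI) simp_all

lemma bop_comp: assumes "bop A" "bop B" shows "bop (\<lambda>x. A (B x))"
  by (rule bopI)
    (simp_all add: bounded_linear_compose[OF bop_bounded_linear bop_bounded_linear] assms bopD)

lemma bop_plus: assumes "bop A" "bop B" shows "bop (\<lambda>x. A x + B x)"
  by (rule bopI)
    (simp_all add: bounded_linear_add bop_bounded_linear assms bopD cscale_add_right)

lemma bop_minus: assumes "bop A" "bop B" shows "bop (\<lambda>x. A x - B x)"
  by (rule bopI)
    (simp_all add: bounded_linear_sub bop_bounded_linear assms bopD cscale_diff_right)

lemma bop_scaleR: assumes "bop A" shows "bop (\<lambda>x. scaleR r (A x))"
  by (rule bopI)
    (simp_all add: bounded_linear_scaleR_right bounded_linear_compose[OF bounded_linear_scaleR_right]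
      bop_bounded_linear assms bopD cscale_scaleR)

lemma bop_funpow: "bop A \<Longrightarrow> bop (A ^^ n)"
  by (induction n) (auto simp: id_def bop_id o_def bop_comp)

lemmas bop_intros = bop_id bop_zero bop_comp bop_plus bop_minus bop_scaleR

lemma bop_tendsto: "bop A \<Longrightarrow> f \<longlonglongrightarrow> x \<Longrightarrow> (\<lambda>n. A (f n)) \<longlonglongrightarrow> A x"
  by (rule bounded_linear.tendsto[OF bop_bounded_linear])

section \<open>Quadratic forms, positivity and contractions\<close>

definition selfadj :: "('a::chilbert \<Rightarrow> 'a) \<Rightarrow> bool" where
  "selfadj A \<longleftrightarrow> bop A \<and> (\<forall>x y. cinner (A x) y = cinner x (A y))"

lemma selfadjD: "selfadj A \<Longrightarrow> cinner (A x) y = cinner x (A y)"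
  by (simp add: selfadj_def)

lemma selfadj_bop: "selfadj A \<Longrightarrow> bop A"
  by (simp add: selfadj_def)

text \<open>Polarisation over the complex numbers: the form at \<open>x + y\<close> gives the sum of
  the two mixed terms, the form at \<open>x + i y\<close> their difference, so both vanish.\<close>

lemma clinear_eq_0_of_form:
  assumes A: "clinear_map A" and 0: "\<And>x. cinner x (A x) = 0"
  shows "A x = 0"
proof -
  have "cinner y (A x) = 0" for y
  proof -
    have "cinner y (A x) + cinner x (A y) = 0"
      using 0[of "x + y"] by (simp add: clinear_mapD[OF A] cinner_simps 0)
    moreover have "\<i> * cinner x (A y) - \<i> * cinner y (A x) = 0"
      using 0[of "x + cscale \<i> y"] by (simp add: clinear_mapD[OF A] cinner_simps 0)
    then have "cinner x (A y) = cinner y (A x)"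
      by (metis complex_i_not_zero mult_cancel_left right_minus_eq)
    ultimately show ?thesis by simp
  qed
  then show ?thesis by (metis cinner_self_eq_0)
qed

text \<open>\<open>opos\<close> asks only for a real nonnegative quadratic form. Realness at
  \<open>x + y\<close> and at \<open>x + i y\<close> makes the mixed terms conjugate to each other,
  which is symmetry.\<close>

lemma opos_selfadj: assumes "opos A" shows "selfadj A"
proof -
  have A: "bop A" and im: "\<And>x. Im (cinner x (A x)) = 0" using assms by (auto simp: opos_def)
  have "cinner (A x) y = cinner x (A y)" for x y
  proof -
    have "Im (cinner x (A y)) + Im (cinner y (A x)) = 0"
      using im[of "x + y"] by (simp add: bopD[OF A] cinner_simps im)
    moreover have "Re (cinner x (A y)) - Re (cinner y (A x)) = 0"
      using im[of "x + cscale \<i> y"] by (simp add: bopD[OF A] cinner_simps im)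
    ultimately have "cinner x (A y) = cnj (cinner y (A x))" by (simp add: complex_eq_iff)
    then show ?thesis by (metis cinner_commute)
  qed
  with A show ?thesis by (simp add: selfadj_def)
qed

lemma selfadj_Im: "selfadj A \<Longrightarrow> Im (cinner x (A x)) = 0"
  by (metis Reals_cnj_iff cinner_commute complex_is_Real_iff selfadjD)

lemma oposI: "selfadj A \<Longrightarrow> (\<And>x. 0 \<le> Re (cinner x (A x))) \<Longrightarrow> opos A"
  by (simp add: opos_def selfadj_Im selfadj_bop)

lemma oposD: "opos A \<Longrightarrow> 0 \<le> Re (cinner x (A x))"
  by (simp add: opos_def)

lemma opos_id: "opos (\<lambda>x. x)"
  by (simp add: opos_def bop_id cinner_self del: of_real_power)

text \<open>The form at \<open>x - r * cnj s * y\<close>, with \<open>s\<close> the mixed term, is a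
  nonnegative quadratic polynomial in the real variable \<open>r\<close>; the factor
  \<open>cnj s\<close> makes its linear coefficient real.\<close>

lemma opos_Cauchy_Schwarz:
  assumes "opos A"
  shows "(cmod (cinner x (A y)))\<^sup>2 \<le> Re (cinner x (A x)) * Re (cinner y (A y))"
proof -
  note sa = opos_selfadj[OF assms] and A = selfadj_bop[OF opos_selfadj[OF assms]]
  define s where "s = cinner x (A y)"
  have yx: "cinner y (A x) = cnj s" by (metis cinner_commute s_def selfadjD[OF sa])
  let ?m = "(cmod s)\<^sup>2" and ?\<alpha> = "Re (cinner x (A x))" and ?\<beta> = "Re (cinner y (A y))"
  have ss: "s * cnj s = complex_of_real ?m" by (simp only: complex_norm_square[of s])
  have q: "0 \<le> ?\<alpha> - 2 * r * ?m + r\<^sup>2 * ?m * ?\<beta>" for r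
  proof -
    let ?z = "cscale (complex_of_real r * cnj s) y"
    have xz: "cinner x (A ?z) = complex_of_real (r * ?m)"
      by (simp only: bopD[OF A] cinner_simps s_def[symmetric] mult.assoc mult.commute[of "cnj s"] ss of_real_mult)
    have zx: "cinner ?z (A x) = complex_of_real (r * ?m)"
      by (metis xz cinner_commute complex_cnj_complex_of_real selfadjD[OF sa])
    have ycoef: "cinner y (A y) = complex_of_real ?\<beta>"
      using assms by (simp add: opos_def complex_eq_iff)
    have "cinner ?z (A ?z) = complex_of_real r * complex_of_real r * (s * cnj s) * cinner y (A y)"
      by (simp only: bopD[OF A] cinner_simps complex_cnj_mult complex_cnj_complex_of_real
          complex_cnj_cnj mult_ac)
    also have "\<dots> = complex_of_real (r\<^sup>2 * ?m * ?\<beta>)"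
      by (subst ycoef) (simp only: ss of_real_mult[symmetric] power2_eq_square)
    finally have zz: "cinner ?z (A ?z) = complex_of_real (r\<^sup>2 * ?m * ?\<beta>)" .
    have "Re (cinner (x - ?z) (A (x - ?z))) = ?\<alpha> - 2 * r * ?m + r\<^sup>2 * ?m * ?\<beta>"
      unfolding clinear_mapD(6)[OF bop_clinear[OF A]] cinner_diff_left cinner_diff_right xz zx zz
      by (simp only: minus_complex.sel Re_complex_of_real)
    then show ?thesis using oposD[OF assms, of "x - ?z"] by simp
  qed
  show ?thesis
  proof (cases "?\<beta> = 0")
    case True
    have "?m = 0"
    proof (rule ccontr)
      assume "?m \<noteq> 0"
      \<comment> \<open>Here the polynomial is affine with negative slope, and this \<open>r\<close>
        gives it the value -1.\<close>
      then show False using q[of "(?\<alpha> + 1) / (2 * ?m)"] True by (simp add: field_simps)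
    qed
    then show ?thesis using True s_def by simp
  next
    case False
    then have "?\<beta> > 0" using oposD[OF assms, of y] by simp
    \<comment> \<open>This \<open>r\<close> is the minimiser of the polynomial.\<close>
    then show ?thesis using q[of "1 / ?\<beta>"] unfolding s_def[symmetric]
      by (simp add: field_simps power2_eq_square)
  qed
qed

lemma norm_cinner_le: "cmod (cinner x y) \<le> norm x * norm y" for x y :: "'a::chilbert"
proof (rule power2_le_imp_le)
  show "(cmod (cinner x y))\<^sup>2 \<le> (norm x * norm y)\<^sup>2"
    using opos_Cauchy_Schwarz[OF opos_id, of x y] by (simp add: cinner_self power_mult_distrib)
qed simp

lemma bounded_bilinear_cinner: "bounded_bilinear (cinner :: 'a::chilbert \<Rightarrow> 'a \<Rightarrow> complex)"
  by (rule bounded_bilinear.intro)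
    (auto simp: cinner_simps scaleR_conv_of_real intro!: exI[of _ 1] norm_cinner_le)

lemmas tendsto_cinner = bounded_bilinear.tendsto[OF bounded_bilinear_cinner]

text \<open>Cauchy-Schwarz against the vector \<open>A x\<close>. This is the device that later
  turns equalities of quadratic forms into statements about kernels and fixed vectors.\<close>

lemma opos_form_eq_0: assumes "opos A" "Re (cinner x (A x)) = 0" shows "A x = 0"
  using opos_Cauchy_Schwarz[OF assms(1), of "A x" x] assms(2) by simp

lemma norm_add_squared: "(norm (x + y))\<^sup>2 = (norm x)\<^sup>2 + 2 * Re (cinner x y) + (norm y)\<^sup>2"
  for x y :: "'a::chilbert"
proof -
  have "Re (cinner (x + y) (x + y)) = Re (cinner x x) + 2 * Re (cinner x y) + Re (cinner y y)"
    using arg_cong[OF cinner_commute[of y x], of Re] by (simp add: cinner_simps)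
  then show ?thesis by (simp add: cinner_self del: of_real_power)
qed

lemma norm_diff_squared: "(norm (x - y))\<^sup>2 = (norm x)\<^sup>2 - 2 * Re (cinner x y) + (norm y)\<^sup>2"
  for x y :: "'a::chilbert"
  using norm_add_squared[of x "- y"] by (simp add: cinner_simps)

lemma selfadj_contraction:
  assumes x: "selfadj x" and le: "opos (\<lambda>h. h - x h)" and ge: "opos (\<lambda>h. h + x h)"
  shows "norm (x h) \<le> norm h"
proof (cases "x h = 0")
  case False
  define n m where "n = norm (x h)" and "m = norm h"
  have n: "n > 0" using False by (simp add: n_def)
  \<comment> \<open>\<open>k\<close> points along \<open>x h\<close> and has the length of
    \<open>h\<close>. So the mixed terms equal \<open>norm h * norm (x h)\<close>, while the
    parallelogram law bounds the forms at \<open>h + k\<close> and \<open>h - k\<close> by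
    \<open>4 * (norm h)^2\<close> in total.\<close>
  define k where "k = (m / n) *\<^sub>R x h"
  note lin = bopD[OF selfadj_bop[OF x]]
  have up: "Re (cinner z (x z)) \<le> (norm z)\<^sup>2" for z
    using oposD[OF le, of z] by (simp add: cinner_simps cinner_self del: of_real_power)
  have low: "- Re (cinner z (x z)) \<le> (norm z)\<^sup>2" for z
    using oposD[OF ge, of z] by (simp add: cinner_simps cinner_self del: of_real_power)
  have hk: "Re (cinner h (x k)) = m * n"
    using n by (simp add: k_def lin cinner_scaleR_right selfadjD[OF x, symmetric] cinner_self
        n_def[symmetric] power2_eq_square del: of_real_power)
  have kh: "Re (cinner k (x h)) = m * n"
    using n by (simp add: k_def cinner_scaleR_left cinner_self n_def[symmetric] power2_eq_square
        del: of_real_power)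
  have "4 * (m * n) = Re (cinner (h + k) (x (h + k))) - Re (cinner (h - k) (x (h - k)))"
    by (simp add: lin cinner_simps hk kh)
  also have "\<dots> \<le> (norm (h + k))\<^sup>2 + (norm (h - k))\<^sup>2"
    using up[of "h + k"] low[of "h - k"] by simp
  also have "\<dots> = 2 * m\<^sup>2 + 2 * (norm k)\<^sup>2"
    by (simp add: norm_add_squared norm_diff_squared m_def)
  also have "norm k = m" using n by (simp add: k_def n_def m_def)
  finally have mn: "m * n \<le> m * m" by (simp add: power2_eq_square)
  have "h \<noteq> 0" using False lin(4) by auto
  then have "m > 0" by (simp add: m_def)
  with mn show ?thesis by (simp add: n_def m_def)
qed simp

lemma opos_contraction:
  assumes "ole (\<lambda>_. 0) A" "ole A id" shows "norm (A x) \<le> norm x"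
proof (rule selfadj_contraction)
  have A: "opos A" using assms(1) by (simp add: ole_def)
  then show sA: "selfadj A" by (rule opos_selfadj)
  show "opos (\<lambda>h. h - A h)" using assms(2) by (simp add: ole_def)
  show "opos (\<lambda>h. h + A h)"
    using A by (auto simp: opos_def bop_intros cinner_simps cinner_self simp del: of_real_power)
qed

section \<open>Orthogonal projections and adjoints\<close>

definition csubspace :: "'a::chilbert set \<Rightarrow> bool" where
  "csubspace S \<longleftrightarrow> 0 \<in> S \<and> (\<forall>x\<in>S. \<forall>y\<in>S. x + y \<in> S) \<and> (\<forall>c. \<forall>x\<in>S. cscale c x \<in> S)"

lemma csubspaceD:
  assumes "csubspace S"
  shows "0 \<in> S" "x \<in> S \<Longrightarrow> y \<in> S \<Longrightarrow> x + y \<in> S" "x \<in> S \<Longrightarrow> cscale c x \<in> S"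
    "x \<in> S \<Longrightarrow> scaleR r x \<in> S" "x \<in> S \<Longrightarrow> - x \<in> S" "x \<in> S \<Longrightarrow> y \<in> S \<Longrightarrow> x - y \<in> S"
proof -
  show "0 \<in> S" and add: "x \<in> S \<Longrightarrow> y \<in> S \<Longrightarrow> x + y \<in> S" and sc: "x \<in> S \<Longrightarrow> cscale c x \<in> S" for x y c
    using assms by (auto simp: csubspace_def)
  show "x \<in> S \<Longrightarrow> scaleR r x \<in> S" by (metis sc cscale_of_real)
  show m: "x \<in> S \<Longrightarrow> - x \<in> S" for x by (metis sc cscale_simps(4))
  show "x \<in> S \<Longrightarrow> y \<in> S \<Longrightarrow> x - y \<in> S" by (metis add m add_uminus_conv_diff)
qed

lemma parallelogram: "(norm (x + y))\<^sup>2 + (norm (x - y))\<^sup>2 = 2 * (norm x)\<^sup>2 + 2 * (norm y)\<^sup>2"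
  for x y :: "'a::chilbert"
  by (simp add: norm_add_squared norm_diff_squared)

text \<open>The midpoint of two near-minimisers stays in \<open>S\<close>, so the parallelogram law
  makes a minimising sequence Cauchy.\<close>

lemma closest_point_exists:
  fixes S :: "'a::chilbert set"
  assumes "closed S" "csubspace S"
  shows "\<exists>u\<in>S. \<forall>k\<in>S. norm (h - u) \<le> norm (h - k)"
proof -
  define d where "d = infdist h S"
  have ne: "S \<noteq> {}" using csubspaceD(1)[OF assms(2)] by blast
  have d0: "0 \<le> d" by (simp add: d_def infdist_nonneg)
  have dle: "d \<le> norm (h - k)" if "k \<in> S" for k
    using infdist_le[OF that, of h] by (simp add: d_def dist_norm)
  have "\<exists>k\<in>S. norm (h - k) < d + inverse (real (Suc n))" for n
  proof -
    have "(INF a\<in>S. dist h a) < d + inverse (real (Suc n))"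
      using ne by (simp add: d_def infdist_notempty)
    then show ?thesis
      by (subst (asm) cINF_less_iff) (auto simp: ne dist_norm intro!: bdd_belowI[of _ 0])
  qed
  then obtain s where sS: "\<And>n. s n \<in> S" and sd: "\<And>n. norm (h - s n) < d + inverse (real (Suc n))"
    by metis
  have mid: "4 * d\<^sup>2 \<le> (norm ((h - s m) + (h - s n)))\<^sup>2" for m n
  proof -
    have "(1/2) *\<^sub>R (s m + s n) \<in> S" by (simp add: csubspaceD[OF assms(2)] sS)
    from dle[OF this] have "2 * d \<le> norm (2 *\<^sub>R (h - (1/2) *\<^sub>R (s m + s n)))" by simp
    also have "2 *\<^sub>R (h - (1/2) *\<^sub>R (s m + s n)) = (h - s m) + (h - s n)"
      by (simp add: scaleR_diff_right scaleR_2)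
    finally have "(2 * d)\<^sup>2 \<le> (norm ((h - s m) + (h - s n)))\<^sup>2"
      using d0 by (intro power_mono) auto
    then show ?thesis by (simp add: power_mult_distrib)
  qed
  have "Cauchy s"
  proof (rule metric_CauchyI)
    fix e :: real assume "0 < e"
    \<comment> \<open>Two terms within \<open>d + \<delta>\<close> of \<open>h\<close> have squared
      distance at most \<open>8 * d * \<delta> + 4 * \<delta>^2\<close>. The bound 1 replaces the
      square of \<delta> by \<delta>, and 5 instead of 4 makes the final inequality strict.\<close>
    define \<delta> where "\<delta> = min 1 (e\<^sup>2 / (8 * d + 5))"
    have \<delta>: "0 < \<delta>" "\<delta> \<le> 1" "\<delta> * (8 * d + 5) \<le> e\<^sup>2"
    proof -
      have d5: "0 < 8 * d + 5" using d0 by simp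
      then show "0 < \<delta>" "\<delta> \<le> 1" using \<open>0 < e\<close> by (simp_all add: \<delta>_def)
      have "\<delta> \<le> e\<^sup>2 / (8 * d + 5)" by (simp add: \<delta>_def)
      then show "\<delta> * (8 * d + 5) \<le> e\<^sup>2" using d5 by (simp only: pos_le_divide_eq)
    qed
    obtain N where N: "inverse (real (Suc N)) < \<delta>" using reals_Archimedean[OF \<delta>(1)] by blast
    have near: "(norm (h - s n))\<^sup>2 \<le> (d + \<delta>)\<^sup>2" if "n \<ge> N" for n
    proof -
      have "inverse (real (Suc n)) \<le> inverse (real (Suc N))" using that by (simp add: field_simps)
      then have "norm (h - s n) \<le> d + \<delta>" using sd[of n] N by linarith
      then show ?thesis by (intro power_mono) auto
    qed
    have "dist (s m) (s n) < e" if mn: "m \<ge> N" "n \<ge> N" for m n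
    proof (rule power2_less_imp_less)
      have "(norm (s m - s n))\<^sup>2 = (norm ((h - s m) - (h - s n)))\<^sup>2"
        by (simp add: norm_minus_commute)
      also have "\<dots> \<le> 4 * (d + \<delta>)\<^sup>2 - 4 * d\<^sup>2"
        using parallelogram[of "h - s m" "h - s n"] mid[of m n] near[OF mn(1)] near[OF mn(2)] by linarith
      also have "\<dots> = 8 * d * \<delta> + 4 * (\<delta> * \<delta>)" by (simp add: power2_eq_square algebra_simps)
      also have "\<dots> \<le> 8 * d * \<delta> + 4 * \<delta>" using \<delta> by simp
      also have "\<dots> < \<delta> * (8 * d + 5)" using \<delta> by (simp add: algebra_simps)
      also have "\<dots> \<le> e\<^sup>2" by fact
      finally show "(dist (s m) (s n))\<^sup>2 < e\<^sup>2" by (simp add: dist_norm)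
    qed (use \<open>0 < e\<close> in simp)
    then show "\<exists>M. \<forall>m\<ge>M. \<forall>n\<ge>M. dist (s m) (s n) < e" by blast
  qed
  then obtain u where u: "s \<longlonglongrightarrow> u" using Cauchy_convergent convergent_def by blast
  have "u \<in> S" using closed_sequentially[OF assms(1) _ u] sS by blast
  have "(\<lambda>n. norm (h - s n)) \<longlonglongrightarrow> norm (h - u)" by (intro tendsto_intros u)
  moreover have "(\<lambda>n. d + inverse (real (Suc n))) \<longlonglongrightarrow> d + 0"
    by (intro tendsto_intros LIMSEQ_inverse_real_of_nat)
  ultimately have "norm (h - u) \<le> d + 0"
    by (rule LIMSEQ_le) (use sd less_imp_le in blast)
  then have "norm (h - u) \<le> norm (h - k)" if "k \<in> S" for k using dle[OF that] by simp
  then show ?thesis using \<open>u \<in> S\<close> by blast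
qed

lemma orthogonal_decomposition:
  fixes S :: "'a::chilbert set"
  assumes "closed S" "csubspace S"
  shows "\<exists>u\<in>S. \<forall>k\<in>S. cinner k (h - u) = 0"
proof -
  obtain u where u: "u \<in> S" "\<And>k. k \<in> S \<Longrightarrow> norm (h - u) \<le> norm (h - k)"
    using closest_point_exists[OF assms] by metis
  have "cinner k (h - u) = 0" if k: "k \<in> S" for k
  proof -
    define w where "w = h - u"
    \<comment> \<open>The step length of the variation of \<open>u\<close> along \<open>k\<close>.
      The summand 1 covers \<open>k = 0\<close> and keeps \<open>r * (norm k)^2\<close> below 1, so
      that the quadratic term cannot compensate the linear one.\<close>
    define r where "r = inverse ((norm k)\<^sup>2 + 1)"
    define z where "z = cscale (complex_of_real r * cinner k w) k"
    let ?m = "(cmod (cinner k w))\<^sup>2"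
    have k1: "(norm k)\<^sup>2 + 1 > 0" by (smt (verit) zero_le_power2)
    have r: "r > 0" "r * (norm k)\<^sup>2 \<le> 1" using k1 by (auto simp: r_def field_simps)
    have "u + z \<in> S" by (simp add: z_def csubspaceD[OF assms(2)] u k)
    then have "norm w \<le> norm (w - z)" using u(2) by (simp add: w_def algebra_simps)
    then have "(norm w)\<^sup>2 \<le> (norm w)\<^sup>2 - 2 * Re (cinner w z) + (norm z)\<^sup>2"
      unfolding norm_diff_squared[symmetric] by simp
    moreover have "cinner w z = complex_of_real (r * ?m)"
      unfolding z_def cinner_scale_right of_real_mult complex_norm_square
      by (simp add: cinner_commute[of k w] mult.assoc)
    moreover have "(norm z)\<^sup>2 = r * ?m * (r * (norm k)\<^sup>2)"
      by (simp add: z_def norm_cscale norm_mult power_mult_distrib power2_eq_square mult_ac)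
    ultimately have "2 * (r * ?m) \<le> r * ?m * (r * (norm k)\<^sup>2)" by simp
    also have "\<dots> \<le> r * ?m * 1" using r by (intro mult_left_mono) auto
    finally have "r * ?m \<le> 0" by simp
    then have "?m \<le> 0" using r(1) by (simp add: mult_le_0_iff)
    then show ?thesis by (simp add: w_def)
  qed
  then show ?thesis using u(1) by blast
qed

lemma projection_exists:
  fixes S :: "'a::chilbert set"
  assumes "closed S" "csubspace S"
  shows "\<exists>P. selfadj P \<and> (\<forall>h. P (P h) = P h) \<and> range P = S"
proof -
  obtain P where PS: "\<And>h. P h \<in> S" and Po: "\<And>h k. k \<in> S \<Longrightarrow> cinner k (h - P h) = 0"
    using orthogonal_decomposition[OF assms] by metis
  have uniq: "P h = u" if "u \<in> S" "\<And>k. k \<in> S \<Longrightarrow> cinner k (h - u) = 0" for h u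
  proof -
    have "P h - u \<in> S" by (simp add: csubspaceD[OF assms(2)] PS that)
    from Po[OF this, of h] that(2)[OF this]
    have "cinner (P h - u) (h - u) - cinner (P h - u) (h - P h) = 0" by simp
    then have "cinner (P h - u) (P h - u) = 0" by (simp add: cinner_diff_right)
    then show ?thesis by simp
  qed
  have fix_P: "P u = u" if "u \<in> S" for u by (rule uniq) (simp_all add: that)
  have sym: "cinner (P x) y = cinner x (P y)" for x y
  proof -
    have "cinner (P x) y = cinner (P x) (P y)" using Po[OF PS, of x y] by (simp add: cinner_simps)
    also have "\<dots> = cinner x (P y)"
      using Po[OF PS, of y x] cinner_commute[of "P y" "x - P x"] by (simp add: cinner_simps)
    finally show ?thesis .
  qed
  \<comment> \<open>Linearity is read off from symmetry: moved to the other side of the inner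
    product, \<open>P\<close> no longer acts on the sum or multiple.\<close>
  have cl: "clinear_map P" unfolding clinear_map_def
  proof (intro conjI allI)
    fix x y c
    show "P (x + y) = P x + P y" by (rule cinner_ext) (simp add: sym[symmetric] cinner_simps)
    show "P (cscale c x) = cscale c (P x)" by (rule cinner_ext) (simp add: sym[symmetric] cinner_simps)
  qed
  have "norm (P x) \<le> 1 * norm x" for x
  proof (rule power2_le_imp_le)
    have "cinner (P x) (x - P x) = 0" by (rule Po) (rule PS)
    then have "(norm (P x + (x - P x)))\<^sup>2 = (norm (P x))\<^sup>2 + (norm (x - P x))\<^sup>2"
      unfolding norm_add_squared by simp
    then show "(norm (P x))\<^sup>2 \<le> (1 * norm x)\<^sup>2" by simp
  qed simp
  then have "selfadj P" using cl sym unfolding selfadj_def bop_def by blast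
  moreover have "range P = S" using PS fix_P by (auto simp: image_iff) metis
  ultimately show ?thesis using fix_P PS by blast
qed

section \<open>Riesz representation, adjoints and projections\<close>

lemma Riesz_representation:
  fixes \<phi> :: "'a::chilbert \<Rightarrow> complex"
  assumes "bounded_linear \<phi>" "\<And>c x. \<phi> (cscale c x) = c * \<phi> x"
  shows "\<exists>z. \<forall>x. \<phi> x = cinner z x"
proof (cases "\<forall>x. \<phi> x = 0")
  case True
  then show ?thesis by (intro exI[of _ 0]) simp
next
  case False
  then obtain h where h: "\<phi> h \<noteq> 0" by blast
  interpret bounded_linear \<phi> by fact
  let ?S = "{x. \<phi> x = 0}"
  have "closed ?S" by (intro closed_Collect_eq linear_continuous_on assms(1) continuous_on_const)
  moreover have "csubspace ?S" by (auto simp: csubspace_def add zero assms(2))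
  ultimately obtain u where u: "\<phi> u = 0" "\<And>k. \<phi> k = 0 \<Longrightarrow> cinner k (h - u) = 0"
    using orthogonal_decomposition[of ?S h] by auto
  define w where "w = h - u"
  have w: "\<phi> w \<noteq> 0" using h u(1) by (simp add: w_def diff)
  then have w0: "cinner w w \<noteq> 0" using zero by auto
  have "\<phi> x = cinner (cscale (cnj (\<phi> w / cinner w w)) w) x" for x
  proof -
    \<comment> \<open>This combination lies in the kernel, to which \<open>w\<close> is
      orthogonal.\<close>
    have "\<phi> (cscale (\<phi> w) x - cscale (\<phi> x) w) = 0" by (simp add: diff assms(2))
    then have "cinner w (cscale (\<phi> w) x - cscale (\<phi> x) w) = 0"
      using u(2) cinner_commute unfolding w_def by (metis complex_cnj_zero)
    then have "\<phi> w * cinner w x = \<phi> x * cinner w w" by (simp add: cinner_simps)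
    then show ?thesis using w0 by (simp add: cinner_simps field_simps)
  qed
  then show ?thesis by blast
qed

lemma adj_eqI: assumes "\<And>x y. cinner (A x) y = cinner x (B y)" shows "adj A = B"
  unfolding adj_def
proof (rule the_equality)
  fix C assume "\<forall>x y. cinner (A x) y = cinner x (C y)"
  then show "C = B" using assms by (intro ext cinner_ext) metis
qed (use assms in blast)

lemma cinner_adj: assumes "bop A" shows "cinner (A x) y = cinner x (adj A y)"
proof -
  have "\<exists>z. \<forall>x. cinner y (A x) = cinner z x" for y
    by (rule Riesz_representation)
      (simp_all add: bounded_linear_compose[OF bounded_bilinear.bounded_linear_right[OF
        bounded_bilinear_cinner] bop_bounded_linear] assms bopD cinner_simps)
  then obtain B where "\<And>x y. cinner y (A x) = cinner (B y) x" by metis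
  then have "cinner (A x) y = cinner x (B y)" for x y by (metis cinner_commute)
  then show ?thesis using adj_eqI[of A B] by simp
qed

lemma selfadj_iff: "selfadj A \<longleftrightarrow> bop A \<and> adj A = A"
  using adj_eqI[of A A] cinner_adj[of A] unfolding selfadj_def by metis

lemma is_proj_iff: "is_proj P \<longleftrightarrow> selfadj P \<and> (\<forall>h. P (P h) = P h)"
  unfolding is_proj_def selfadj_iff by (auto simp: fun_eq_iff)

lemma is_projD: assumes "is_proj P"
  shows "selfadj P" "bop P" "P (P h) = P h" "cinner (P x) y = cinner x (P y)"
    "cinner x (P x) = complex_of_real ((norm (P x))\<^sup>2)" "opos P" "norm (P x) \<le> norm x"
proof -
  show P: "selfadj P" "bop P" "P (P h) = P h" "cinner (P x) y = cinner x (P y)" for h x y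
    using assms by (auto simp: is_proj_iff selfadj_def)
  show form: "cinner x (P x) = complex_of_real ((norm (P x))\<^sup>2)" for x
    by (metis P(3,4) cinner_self)
  show "opos P" by (rule oposI) (simp_all add: P form del: of_real_power)
  have "cinner (P x) (x - P x) = 0"
    by (metis P(3,4) cinner_diff_right cancel_comm_monoid_add_class.diff_cancel)
  then have "(norm (P x + (x - P x)))\<^sup>2 = (norm (P x))\<^sup>2 + (norm (x - P x))\<^sup>2"
    unfolding norm_add_squared by simp
  then have "(norm x)\<^sup>2 = (norm (P x))\<^sup>2 + (norm (x - P x))\<^sup>2" by simp
  then show "norm (P x) \<le> norm x" by (intro power2_le_imp_le[where x = "norm (P x)"]) auto
qed

lemma is_proj_compl: assumes "is_proj P" shows "is_proj (\<lambda>h. h - P h)"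
  using is_projD[OF assms] by (auto simp: is_proj_iff selfadj_def cinner_simps bop_intros bopD)

lemma proj_range_iff: "is_proj P \<Longrightarrow> h \<in> range P \<longleftrightarrow> P h = h"
  by (auto simp: is_projD(3) intro: range_eqI[of _ P h])

lemma proj_eq_of_range:
  assumes "is_proj P" "is_proj Q" "range P = range Q" shows "P = Q"
proof (intro ext cinner_ext)
  fix x y
  have "cinner y (P x) = cinner y (Q (P x))"
    using proj_range_iff[OF assms(2), of "P x"] assms(3) by (metis rangeI)
  also have "\<dots> = cinner (P (Q y)) x" using is_projD(4) assms by metis
  also have "P (Q y) = Q y"
    using proj_range_iff[OF assms(1), of "Q y"] assms(3) by (metis rangeI)
  finally show "cinner y (P x) = cinner y (Q x)" using is_projD(4)[OF assms(2)] by simp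
qed

section \<open>Range projections\<close>

lemma csubspace_range: assumes "bop A" shows "csubspace (range A)"
  unfolding csubspace_def
proof (intro conjI ballI allI)
  show "0 \<in> range A" using bopD(4)[OF assms] by (rule range_eqI[OF sym])
next
  fix x y assume "x \<in> range A" "y \<in> range A"
  then obtain u v where "x = A u" "y = A v" by blast
  then show "x + y \<in> range A" using bopD(1)[OF assms, of u v] by (intro range_eqI[of _ _ "u + v"]) simp
next
  fix c x assume "x \<in> range A"
  then obtain u where "x = A u" by blast
  then show "cscale c x \<in> range A" using bopD(2)[OF assms, of c u]
    by (intro range_eqI[of _ _ "cscale c u"]) simp
qed

lemma bop_cscale: "bop (cscale c :: 'a::chilbert \<Rightarrow> 'a)"
  unfolding bop_def clinear_map_def
  by (auto simp: cscale_add_right cscale_assoc mult.commute norm_cscale intro!: exI[of _ "cmod c"])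

lemma csubspace_closure: assumes "csubspace S" shows "csubspace (closure S)"
  unfolding csubspace_def
proof (intro conjI ballI allI)
  show "0 \<in> closure S" using csubspaceD(1)[OF assms] closure_subset by blast
next
  fix x y assume "x \<in> closure S" "y \<in> closure S"
  then obtain f g where f: "\<And>n. f n \<in> S" "f \<longlonglongrightarrow> x" and g: "\<And>n. g n \<in> S" "g \<longlonglongrightarrow> y"
    unfolding closure_sequential by metis
  have "\<forall>n. f n + g n \<in> S" using csubspaceD(2)[OF assms f(1) g(1)] by blast
  then show "x + y \<in> closure S"
    unfolding closure_sequential using tendsto_add[OF f(2) g(2)] by (intro exI conjI)
next
  fix c x assume "x \<in> closure S"
  then obtain f where f: "\<And>n. f n \<in> S" "f \<longlonglongrightarrow> x"
    unfolding closure_sequential by metis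
  have "\<forall>n. cscale c (f n) \<in> S" using csubspaceD(3)[OF assms f(1)] by blast
  then show "cscale c x \<in> closure S"
    unfolding closure_sequential using bop_tendsto[OF bop_cscale f(2)] by (intro exI conjI)
qed

lemma rproj_spec:
  assumes "bop A" shows "is_proj (rproj A)" "range (rproj A) = closure (range A)"
proof -
  obtain P where P: "is_proj P \<and> range P = closure (range A)"
    using projection_exists[OF closed_closure csubspace_closure[OF csubspace_range[OF assms]]] is_proj_iff by blast
  have "is_proj (rproj A) \<and> range (rproj A) = closure (range A)"
    unfolding rproj_def
  proof (rule theI[of _ P])
    show "Q = P" if "is_proj Q \<and> range Q = closure (range A)" for Q
      using that P proj_eq_of_range[of Q P] by simp
  qed (rule P)
  then show "is_proj (rproj A)" "range (rproj A) = closure (range A)" by auto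
qed

lemma rproj_apply: assumes "bop A" shows "rproj A (A h) = A h"
proof -
  have "A h \<in> range (rproj A)" unfolding rproj_spec(2)[OF assms] by (rule subsetD[OF closure_subset rangeI])
  then show ?thesis by (simp add: proj_range_iff[OF rproj_spec(1)[OF assms]])
qed

lemma closure_range_sequential: "x \<in> closure (range A) \<longleftrightarrow> (\<exists>f. (\<lambda>n. A (f n)) \<longlonglongrightarrow> x)"
  for A :: "'a \<Rightarrow> 'b::metric_space"
proof
  assume "x \<in> closure (range A)"
  then obtain g where g: "\<forall>n. g n \<in> range A" "g \<longlonglongrightarrow> x"
    by (auto simp only: closure_sequential)
  have "g n = A (inv A (g n))" for n using g(1) by (simp add: f_inv_into_f)
  then show "\<exists>f. (\<lambda>n. A (f n)) \<longlonglongrightarrow> x" using g(2) by (intro exI[of _ "\<lambda>n. inv A (g n)"]) simp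
next
  assume "\<exists>f. (\<lambda>n. A (f n)) \<longlonglongrightarrow> x"
  then obtain f where "(\<lambda>n. A (f n)) \<longlonglongrightarrow> x" ..
  then show "x \<in> closure (range A)"
    unfolding closure_sequential by (intro exI[of _ "\<lambda>n. A (f n)"]) simp
qed

lemma rproj_approx: assumes "bop A" shows "\<exists>f. (\<lambda>n. A (f n)) \<longlonglongrightarrow> rproj A h"
  unfolding closure_range_sequential[symmetric] rproj_spec(2)[OF assms, symmetric] by (rule rangeI)

lemma rproj_eq_0_iff: assumes "bop A" shows "rproj A h = 0 \<longleftrightarrow> (\<forall>k. cinner (A k) h = 0)"
proof
  assume "rproj A h = 0"
  then show "\<forall>k. cinner (A k) h = 0"
    by (metis assms cinner_zero_right is_projD(4) rproj_apply rproj_spec(1))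
next
  assume 0: "\<forall>k. cinner (A k) h = 0"
  obtain f where "(\<lambda>n. A (f n)) \<longlonglongrightarrow> rproj A h" using rproj_approx[OF assms] by blast
  then have "(\<lambda>n. cinner (A (f n)) h) \<longlonglongrightarrow> cinner (rproj A h) h" by (intro tendsto_cinner tendsto_const)
  then have "cinner (rproj A h) h = 0" using 0 by (simp add: LIMSEQ_const_iff)
  then show "rproj A h = 0" using is_projD(4,5)[OF rproj_spec(1)[OF assms]] by simp
qed

lemma rproj_selfadj_eq_0_iff: assumes "selfadj A" shows "rproj A h = 0 \<longleftrightarrow> A h = 0"
  unfolding rproj_eq_0_iff[OF selfadj_bop[OF assms]] selfadjD[OF assms]
  by (metis cinner_self_eq_0 cinner_zero_right)

text \<open>\<open>B\<close> leaves both the closed range of \<open>A\<close> and the kernel of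
  \<open>A\<close> invariant, and these are the range and the kernel of the projection. This places
  range projections in the bicommutant.\<close>

lemma rproj_commute:
  assumes A: "selfadj A" and B: "bop B" and comm: "\<And>h. A (B h) = B (A h)"
  shows "rproj A (B h) = B (rproj A h)"
proof -
  note bA = selfadj_bop[OF A] and R = is_projD(2,3)[OF rproj_spec(1)[OF selfadj_bop[OF A]]]
  obtain f where f: "(\<lambda>n. A (f n)) \<longlonglongrightarrow> rproj A h" using rproj_approx[OF bA] by blast
  have lim: "(\<lambda>n. B (A (f n))) \<longlonglongrightarrow> B (rproj A h)" using bop_tendsto[OF B f] .
  have "(\<lambda>n. rproj A (B (A (f n)))) \<longlonglongrightarrow> rproj A (B (rproj A h))" using bop_tendsto[OF R(1) lim] .
  moreover have "rproj A (B (A k)) = B (A k)" for k by (metis comm rproj_apply[OF bA])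
  ultimately have 1: "rproj A (B (rproj A h)) = B (rproj A h)" using LIMSEQ_unique lim by simp
  have "A (h - rproj A h) = 0"
    using rproj_selfadj_eq_0_iff[OF A, of "h - rproj A h"] R by (simp add: bopD)
  then have "rproj A (B (h - rproj A h)) = 0"
    by (simp only: rproj_selfadj_eq_0_iff[OF A] comm bopD(4)[OF B])
  then show ?thesis using 1 by (simp add: bopD[OF B] bopD[OF R(1)])
qed

section \<open>Square roots of positive operators\<close>

text \<open>
  The coefficients of the binomial series of \<open>sqrt (1 - t)\<close>. All but the first are nonpositive
  and all partial sums are nonnegative, so the series converges absolutely even at \<open>\<bar>t\<bar> = 1\<close>.
\<close>

definition sqrt_coeff :: "nat \<Rightarrow> real" where
  "sqrt_coeff n = pochhammer (- 1/2) n / fact n"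

lemma sqrt_coeff_0 [simp]: "sqrt_coeff 0 = 1"
  by (simp add: sqrt_coeff_def)

lemma sqrt_coeff_nonpos: "0 < n \<Longrightarrow> sqrt_coeff n \<le> 0"
  by (cases n) (auto simp: sqrt_coeff_def pochhammer_rec divide_nonpos_pos mult_nonneg_nonneg
    intro!: divide_nonneg_nonneg pochhammer_nonneg)

text \<open>Partial sums are the coefficients of \<open>sqrt (1 - t) / (1 - t)\<close>, that is, of
  the binomial series with exponent -1/2.\<close>

lemma sum_sqrt_coeff: "(\<Sum>k\<le>n. sqrt_coeff k) = pochhammer (1/2) n / fact n"
proof (induction n)
  case (Suc n)
  have "pochhammer (- 1/2) (Suc n) = - (1/2) * pochhammer (1/2::real) n"
    by (simp add: pochhammer_rec)
  then show ?case
    using Suc by (simp add: sqrt_coeff_def pochhammer_Suc[of "1/2"] divide_simps) (simp add: algebra_simps)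
qed simp

text \<open>The leading coefficient 1 minus the absolute values of the others stays nonnegative. The
  exact bound 1, beyond convergence, is what makes the operator root positive.\<close>

lemma sum_abs_sqrt_coeff_le: "(\<Sum>k<n. \<bar>sqrt_coeff (Suc k)\<bar>) \<le> 1"
proof -
  have "(\<Sum>k\<le>n. sqrt_coeff k) = 1 + (\<Sum>k<n. sqrt_coeff (Suc k))"
    by (simp add: sum.atMost_shift)
  moreover have "(\<Sum>k<n. \<bar>sqrt_coeff (Suc k)\<bar>) = - (\<Sum>k<n. sqrt_coeff (Suc k))"
    by (simp add: sum_negf[symmetric] abs_of_nonpos sqrt_coeff_nonpos)
  moreover have "0 \<le> (\<Sum>k\<le>n. sqrt_coeff k)"
    unfolding sum_sqrt_coeff by (intro divide_nonneg_nonneg pochhammer_nonneg) auto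
  ultimately show ?thesis by simp
qed

lemma summable_abs_sqrt_coeff: "summable (\<lambda>n. \<bar>sqrt_coeff n\<bar>)"
  and suminf_abs_sqrt_coeff_le: "(\<Sum>n. \<bar>sqrt_coeff (Suc n)\<bar>) \<le> 1"
proof -
  have s: "summable (\<lambda>n. \<bar>sqrt_coeff (Suc n)\<bar>)"
    by (rule summableI_nonneg_bounded) (use sum_abs_sqrt_coeff_le in auto)
  then show "summable (\<lambda>n. \<bar>sqrt_coeff n\<bar>)" by (subst (asm) summable_Suc_iff)
  show "(\<Sum>n. \<bar>sqrt_coeff (Suc n)\<bar>) \<le> 1"
    by (rule suminf_le_const[OF s sum_abs_sqrt_coeff_le])
qed

text \<open>Vandermonde's identity with \<open>1/2 + 1/2 = 1\<close>: the square of the series is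
  \<open>1 - t\<close>.\<close>

lemma sqrt_coeff_convolution:
  "(\<Sum>k\<le>n. sqrt_coeff k * sqrt_coeff (n - k)) = (if n = 0 then 1 else if n = 1 then -1 else 0)"
proof -
  have c: "sqrt_coeff k = (-1) ^ k * ((1/2) gchoose k)" for k
    by (simp add: sqrt_coeff_def gbinomial_pochhammer mult.assoc[symmetric] flip: power_mult_distrib)
  have "(\<Sum>k\<le>n. sqrt_coeff k * sqrt_coeff (n - k)) =
      (\<Sum>k\<in>{0..n}. (-1) ^ n * (((1/2) gchoose k) * ((1/2) gchoose (n - k))))"
    by (rule sum.cong) (auto simp: c atMost_atLeast0 simp flip: power_add)
  also have "\<dots> = (-1) ^ n * ((1/2 + 1/2 :: real) gchoose n)"
    unfolding sum_distrib_left[symmetric] gbinomial_Vandermonde ..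
  also have "(1/2 + 1/2 :: real) gchoose n = of_nat (1 choose n)"
    by (simp add: binomial_gbinomial)
  also have "(-1) ^ n * real (1 choose n) = (if n = 0 then 1 else if n = 1 then -1 else 0)"
    by (auto simp: binomial_eq_0)
  finally show ?thesis .
qed

text \<open>The root of \<open>1 - B\<close>, summed at each vector separately, so that only
  convergence in the space itself is involved.\<close>

definition sqrt_series :: "('a::chilbert \<Rightarrow> 'a) \<Rightarrow> 'a \<Rightarrow> 'a" where
  "sqrt_series B h = (\<Sum>n. sqrt_coeff n *\<^sub>R (B ^^ n) h)"

context
  fixes B :: "'a::chilbert \<Rightarrow> 'a"
  assumes B: "bop B" and contr: "\<And>h. norm (B h) \<le> norm h"
begin

lemma norm_funpow_le: "norm ((B ^^ n) h) \<le> norm h"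
  by (induction n) (auto intro: order_trans[OF contr])

lemma summable_norm_sqrt_series: "summable (\<lambda>n. norm (sqrt_coeff n *\<^sub>R (B ^^ n) h))"
  by (rule summable_comparison_test'[OF summable_mult2[OF summable_abs_sqrt_coeff, of "norm h"]])
    (simp add: mult_left_mono norm_funpow_le)

lemma sqrt_series_sums: "(\<lambda>n. sqrt_coeff n *\<^sub>R (B ^^ n) h) sums sqrt_series B h"
  unfolding sqrt_series_def by (rule summable_sums[OF summable_norm_cancel[OF summable_norm_sqrt_series]])

lemma sqrt_series_has_sum: "((\<lambda>n. sqrt_coeff n *\<^sub>R (B ^^ n) h) has_sum sqrt_series B h) UNIV"
  by (rule norm_summable_imp_has_sum[OF summable_norm_sqrt_series sqrt_series_sums])

lemma sqrt_series_commute: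
  assumes C: "bop C" and comm: "\<And>h. C (B h) = B (C h)"
  shows "C (sqrt_series B h) = sqrt_series B (C h)"
proof -
  have "C ((B ^^ n) h) = (B ^^ n) (C h)" for n
    by (induction n) (simp_all add: comm)
  then have "(\<lambda>n. sqrt_coeff n *\<^sub>R (B ^^ n) (C h)) sums C (sqrt_series B h)"
    using bounded_linear.sums[OF bop_bounded_linear[OF C] sqrt_series_sums[of h]]
    by (simp add: bopD[OF C])
  then show ?thesis using sqrt_series_sums sums_unique2 by blast
qed

text \<open>The tail of the series is dominated by the absolute coefficients, whose sum is at most
  1. Through Cauchy-Schwarz this yields positivity of the root.\<close>

lemma sqrt_series_minus: "norm (h - sqrt_series B h) \<le> norm h"
proof -
  let ?f = "\<lambda>n. sqrt_coeff (Suc n) *\<^sub>R (B ^^ Suc n) h"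
  have sn: "summable (\<lambda>n. norm (?f n))"
    using summable_norm_sqrt_series[of h] by (subst summable_Suc_iff)
  have s: "summable (\<lambda>n. \<bar>sqrt_coeff (Suc n)\<bar> * norm h)"
    using summable_abs_sqrt_coeff by (intro summable_mult2) (subst summable_Suc_iff)
  have "sqrt_series B h = h + suminf ?f"
    using suminf_split_head[OF summable_norm_cancel[OF summable_norm_sqrt_series[of h]]]
    unfolding sqrt_series_def by simp
  then have "norm (h - sqrt_series B h) = norm (suminf ?f)" by simp
  also have "\<dots> \<le> (\<Sum>n. norm (?f n))" by (rule summable_norm[OF sn])
  also have "\<dots> \<le> (\<Sum>n. \<bar>sqrt_coeff (Suc n)\<bar> * norm h)"
    using norm_funpow_le[of "Suc _" h] by (intro suminf_le sn s) (simp add: mult_left_mono)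
  also have "\<dots> = (\<Sum>n. \<bar>sqrt_coeff (Suc n)\<bar>) * norm h"
    using summable_abs_sqrt_coeff by (intro suminf_mult2[symmetric]) (subst summable_Suc_iff)
  also have "\<dots> \<le> 1 * norm h" by (intro mult_right_mono suminf_abs_sqrt_coeff_le) simp
  finally show ?thesis by simp
qed

lemma sqrt_series_bop: "bop (sqrt_series B)"
  unfolding bop_def clinear_map_def
proof (intro conjI allI exI)
  fix x y c
  have "bop (B ^^ n)" for n by (rule bop_funpow[OF B])
  note lin = bopD(1,2)[OF this]
  show "sqrt_series B (x + y) = sqrt_series B x + sqrt_series B y"
    using sums_add[OF sqrt_series_sums[of x] sqrt_series_sums[of y]] sqrt_series_sums[of "x + y"]
    by (simp add: lin scaleR_add_right[symmetric]) (rule sums_unique2)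
  show "sqrt_series B (cscale c x) = cscale c (sqrt_series B x)"
    by (rule sqrt_series_commute[OF bop_cscale, symmetric]) (simp add: bopD[OF B])
  show "norm (sqrt_series B x) \<le> 2 * norm x"
    using sqrt_series_minus[of x] norm_triangle_ineq4[of x "x - sqrt_series B x"] by simp
qed

text \<open>The double series is absolutely summable. Summed by rows it is the iterated root; summed
  along the antidiagonals it collapses by the convolution identity to its terms of degree 0 and
  1.\<close>

lemma sqrt_series_square: "sqrt_series B (sqrt_series B h) = h - B h"
proof -
  let ?g = sqrt_coeff
  let ?F = "\<lambda>(n, k). (?g n * ?g k) *\<^sub>R (B ^^ (n + k)) h"
  have g: "((\<lambda>n. \<bar>?g n\<bar>) has_sum (\<Sum>n. \<bar>?g n\<bar>)) UNIV"
    using summable_abs_sqrt_coeff by (intro norm_summable_imp_has_sum) auto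
  have "(\<lambda>(n, k). \<bar>?g n\<bar> * (\<bar>?g k\<bar> * norm h)) summable_on UNIV \<times> UNIV"
  proof (rule summable_on_SigmaI)
    show "((\<lambda>k. case (n, k) of (n, k) \<Rightarrow> \<bar>?g n\<bar> * (\<bar>?g k\<bar> * norm h))
        has_sum (\<bar>?g n\<bar> * ((\<Sum>n. \<bar>?g n\<bar>) * norm h))) UNIV" for n
      by (simp add: has_sum_cmult_right has_sum_cmult_left g)
    show "(\<lambda>n. \<bar>?g n\<bar> * ((\<Sum>n. \<bar>?g n\<bar>) * norm h)) summable_on UNIV"
      using g by (intro summable_on_cmult_left) (auto simp: summable_on_def)
  qed auto
  then have "(\<lambda>p. norm (?F p)) summable_on UNIV \<times> UNIV"
    by (rule summable_on_comparison_test)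
      (auto simp: abs_mult mult.assoc intro!: mult_left_mono norm_funpow_le)
  then have "?F summable_on UNIV \<times> UNIV" by (rule abs_summable_summable)
  then obtain X where X: "(?F has_sum X) (UNIV \<times> UNIV)" unfolding summable_on_def by blast
  have pow: "(B ^^ n) (sqrt_series B h) = sqrt_series B ((B ^^ n) h)" for n
    by (rule sqrt_series_commute[OF bop_funpow[OF B]]) (simp add: funpow_swap1)
  have "((\<lambda>k. ?F (n, k)) has_sum (?g n *\<^sub>R (B ^^ n) (sqrt_series B h))) UNIV" for n
  proof -
    have "(B ^^ k) ((B ^^ n) h) = (B ^^ (n + k)) h" for k
      by (simp add: add.commute[of n] funpow_add)
    then show ?thesis
      using has_sum_bounded_linear[OF bounded_linear_scaleR_right sqrt_series_has_sum[of "(B ^^ n) h"], of "?g n"]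
      by (simp add: pow)
  qed
  then have "((\<lambda>n. ?g n *\<^sub>R (B ^^ n) (sqrt_series B h)) has_sum X) UNIV"
    by (intro has_sum_SigmaD[OF X]) auto
  then have X1: "X = sqrt_series B (sqrt_series B h)"
    using sqrt_series_has_sum has_sum_unique by blast
  \<comment> \<open>Antidiagonal \<open>m\<close> is parametrised by its first coordinate
    \<open>i\<close>; \<open>i \<le> m\<close> makes the truncated subtraction exact.\<close>
  have "bij_betw (\<lambda>(m, i). (i, m - i)) (SIGMA m:UNIV. {..m}) (UNIV \<times> (UNIV::nat set))"
    by (rule bij_betwI[where g = "\<lambda>(i, k). (i + k, i)"]) auto
  then have "((\<lambda>mi. ?F (case mi of (m, i) \<Rightarrow> (i, m - i))) has_sum X) (SIGMA m:UNIV. {..m})"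
    using X by (subst has_sum_reindex_bij_betw)
  also have "?this \<longleftrightarrow>
      ((\<lambda>(m, i). (?g i * ?g (m - i)) *\<^sub>R (B ^^ m) h) has_sum X) (SIGMA m:UNIV. {..m})"
    by (rule has_sum_cong) auto
  finally have "((\<lambda>(m, i). (?g i * ?g (m - i)) *\<^sub>R (B ^^ m) h) has_sum X) (SIGMA m:UNIV. {..m})" .
  then have "((\<lambda>m. \<Sum>i\<le>m. (?g i * ?g (m - i)) *\<^sub>R (B ^^ m) h) has_sum X) UNIV"
    by (rule has_sum_SigmaD) auto
  then have "((\<lambda>m. (if m = 0 then 1 else if m = 1 then -1 else 0 :: real) *\<^sub>R (B ^^ m) h) has_sum X) UNIV"
    unfolding scaleR_sum_left[symmetric] sqrt_coeff_convolution .
  moreover have "((\<lambda>m. (if m = 0 then 1 else if m = 1 then -1 else 0 :: real) *\<^sub>R (B ^^ m) h)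
      has_sum (h - B h)) UNIV"
    by (rule has_sum_finite_neutralI[of "{0, 1}"]) auto
  ultimately have "X = h - B h" using has_sum_unique by blast
  with X1 show ?thesis by simp
qed

lemma sqrt_series_opos:
  assumes sym: "\<And>x y. cinner (B x) y = cinner x (B y)"
  shows "opos (sqrt_series B)"
proof (rule oposI)
  have symn: "cinner ((B ^^ n) x) y = cinner x ((B ^^ n) y)" for n x y
    by (induction n arbitrary: x y) (simp_all add: sym funpow_swap1)
  have "cinner (sqrt_series B x) y = cinner x (sqrt_series B y)" for x y
  proof -
    have "(\<lambda>n. sqrt_coeff n * cinner x ((B ^^ n) y)) sums cinner x (sqrt_series B y)"
      using bounded_linear.sums[OF bounded_bilinear.bounded_linear_right[OF bounded_bilinear_cinner]
        sqrt_series_sums] by (simp add: cinner_simps)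
    moreover have "(\<lambda>n. sqrt_coeff n * cinner x ((B ^^ n) y)) sums cinner (sqrt_series B x) y"
      using bounded_linear.sums[OF bounded_bilinear.bounded_linear_left[OF bounded_bilinear_cinner]
        sqrt_series_sums] by (simp add: cinner_simps symn)
    ultimately show ?thesis using sums_unique2 by blast
  qed
  then show "selfadj (sqrt_series B)" by (simp add: selfadj_def sqrt_series_bop)
  fix x
  have "Re (cinner x (x - sqrt_series B x)) \<le> norm x * norm (x - sqrt_series B x)"
    using complex_Re_le_cmod norm_cinner_le order_trans by blast
  also have "\<dots> \<le> (norm x)\<^sup>2"
    unfolding power2_eq_square by (intro mult_left_mono sqrt_series_minus) simp
  finally show "0 \<le> Re (cinner x (sqrt_series B x))"
    by (simp add: cinner_simps cinner_self del: of_real_power)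
qed

end

text \<open>For \<open>y = S x - R x\<close> commutation gives
  \<open>(S + R) y = S^2 x - R^2 x = 0\<close>. Positivity then kills \<open>S y\<close> and
  \<open>R y\<close> separately, so \<open>y\<close> is orthogonal to \<open>S x\<close> and
  \<open>R x\<close>, hence to itself.\<close>

lemma opos_sqrt_unique:
  assumes S: "opos S" and R: "opos R" and sq: "\<And>h. S (S h) = R (R h)"
    and comm: "\<And>h. S (R h) = R (S h)"
  shows "S = R"
proof
  fix x
  note bS = selfadj_bop[OF opos_selfadj[OF S]] and bR = selfadj_bop[OF opos_selfadj[OF R]]
  let ?y = "S x - R x"
  have "S ?y + R ?y = 0" by (simp add: bopD[OF bS] bopD[OF bR] sq comm)
  then have "cinner ?y (S ?y) + cinner ?y (R ?y) = 0" by (metis cinner_add_right cinner_zero_right)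
  then have "Re (cinner ?y (S ?y)) + Re (cinner ?y (R ?y)) = 0"
    by (metis plus_complex.sel(1) zero_complex.sel(1))
  with oposD[OF S, of ?y] oposD[OF R, of ?y]
  have "Re (cinner ?y (S ?y)) = 0" "Re (cinner ?y (R ?y)) = 0" by auto
  then have "S ?y = 0" "R ?y = 0" using opos_form_eq_0 S R by auto
  then have "cinner (S x) ?y = 0" "cinner (R x) ?y = 0"
    using selfadjD[OF opos_selfadj[OF S], of x ?y] selfadjD[OF opos_selfadj[OF R], of x ?y] by simp_all
  then have "cinner ?y ?y = 0" by (simp add: cinner_diff_left)
  then show "S x = R x" by simp
qed

text \<open>The series is applied to the contraction \<open>1 - A\<close>. Any positive root
  commutes with its own square \<open>A\<close>, hence with the series, so uniqueness among
  commuting roots is enough to evaluate the description in \<open>osqrt\<close>.\<close>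

lemma
  assumes "ole (\<lambda>_. 0) A" "ole A id"
  shows osqrt_opos: "opos (osqrt A)"
    and osqrt_square: "osqrt A (osqrt A h) = A h"
    and osqrt_commute: "bop C \<Longrightarrow> (\<And>h. C (A h) = A (C h)) \<Longrightarrow> C (osqrt A h) = osqrt A (C h)"
proof -
  let ?B = "\<lambda>h. h - A h"
  have A: "opos A" and bA: "bop A" and B: "opos ?B"
    using assms by (auto simp: ole_def)
  have bB: "bop ?B" using B opos_def by blast
  have "ole (\<lambda>_. 0) ?B" "ole ?B id" using A B bB by (auto simp: ole_def bop_intros id_def)
  from opos_contraction[OF this] have contr: "norm (?B h) \<le> norm h" for h .
  let ?S = "sqrt_series ?B"
  have S: "opos ?S" by (rule sqrt_series_opos[OF bB contr selfadjD[OF opos_selfadj[OF B]]])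
  have sq: "?S (?S h) = A h" for h using sqrt_series_square[OF bB contr] by simp
  have comm: "C (?S h) = ?S (C h)" if "bop C" "\<And>h. C (A h) = A (C h)" for C h
    by (rule sqrt_series_commute[OF bB contr that(1)]) (simp add: bopD[OF that(1)] that(2))
  have uniq: "R = ?S" if R: "opos R" "\<And>h. R (R h) = A h" for R
  proof (rule opos_sqrt_unique[OF R(1) S])
    have "bop R" using R(1) opos_def by blast
    then show "R (?S h) = ?S (R h)" for h by (rule comm) (simp add: R(2)[symmetric])
  qed (simp add: R(2) sq)
  have "osqrt A = ?S"
    unfolding osqrt_def
  proof (rule the_equality)
    show "opos ?S \<and> ?S \<circ> ?S = A" using S sq by auto
    show "R = ?S" if "opos R \<and> R \<circ> R = A" for R using that by (intro uniq) auto
  qed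
  then show "opos (osqrt A)" "osqrt A (osqrt A h) = A h"
    "bop C \<Longrightarrow> (\<And>h. C (A h) = A (C h)) \<Longrightarrow> C (osqrt A h) = osqrt A (C h)"
    using S sq comm by metis+
qed

section \<open>Strict elements\<close>

lemma opos_antisym:
  assumes "opos (\<lambda>x. B x - A x)" "opos (\<lambda>x. A x - B x)" shows "A = B"
proof
  fix x
  have "cinner y (B y - A y) = 0" for y
    using assms[unfolded opos_def] by (simp add: complex_eq_iff cinner_simps) (meson antisym)
  then show "A x = B x"
    using clinear_eq_0_of_form[of "\<lambda>x. B x - A x" x] assms(1) by (simp add: opos_def bop_clinear)
qed

lemma is_proj_zero: "is_proj zero_op"
  by (simp add: is_proj_iff selfadj_def zero_op_def bop_zero)

lemma ole_zero_iff: "ole zero_op A \<longleftrightarrow> opos A"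
  by (auto simp: ole_def zero_op_def bop_zero opos_def)

lemma ole_Re: "ole A B \<Longrightarrow> Re (cinner x (A x)) \<le> Re (cinner x (B x))"
  using oposD[of "\<lambda>x. B x - A x" x] by (simp add: ole_def cinner_simps)

lemma ole_projI:
  assumes q: "is_proj q" and e: "is_proj e" and eq: "\<And>h. e (q h) = q h" shows "ole q e"
proof -
  have "q (e h) = q h" for h
    by (rule cinner_ext) (metis eq e q is_projD(4))
  then have "norm (q h) \<le> norm (e h)" for h using is_projD(7)[OF q, of "e h"] by simp
  then have "Re (cinner h (q h)) \<le> Re (cinner h (e h))" for h
    by (simp add: is_projD(5)[OF q] is_projD(5)[OF e] power_mono del: of_real_power)
  moreover have "selfadj (\<lambda>h. e h - q h)"
    using is_projD(2,4)[OF e] is_projD(2,4)[OF q] by (simp add: selfadj_def bop_intros cinner_simps)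
  ultimately show ?thesis
    unfolding ole_def using is_projD(2) e q by (auto intro!: oposI simp: cinner_simps)
qed

text \<open>A greatest element is the supremum; this is the only kind of supremum that strictness involves.\<close>

lemma psup_greatest:
  assumes "e \<in> projs N" "e \<in> S" "\<And>s. s \<in> S \<Longrightarrow> ole s e" shows "psup N S = e"
  unfolding psup_def
proof (rule the_equality)
  fix q assume q: "q \<in> projs N \<and> (\<forall>s\<in>S. ole s q) \<and> (\<forall>q'\<in>projs N. (\<forall>s\<in>S. ole s q') \<longrightarrow> ole q q')"
  then have "ole e q" "ole q e" using assms by blast+
  then show "q = e" by (auto simp: ole_def intro: opos_antisym)
qed (use assms in blast)

context
  fixes M :: "('a::chilbert \<Rightarrow> 'a) set"
  assumes M: "vna M"
begin

text \<open>The bicommutant condition in pointwise form: membership means commuting with the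
  commutant, from which all closure properties follow.\<close>

lemma vna_mem_iff: "A \<in> M \<longleftrightarrow> bop A \<and> (\<forall>C\<in>commutant M. \<forall>h. C (A h) = A (C h))"
proof -
  have "A \<in> M \<longleftrightarrow> A \<in> commutant (commutant M)" using M by (simp add: vna_def)
  then show ?thesis by (auto simp: commutant_def[of "commutant M"] fun_eq_iff)
qed

lemma vna_id: "(\<lambda>h. h) \<in> M"
  using M by (simp add: vna_def id_def)

lemma commutantD: "C \<in> commutant M \<Longrightarrow> bop C" "C \<in> commutant M \<Longrightarrow> A \<in> M \<Longrightarrow> A (C h) = C (A h)"
  by (auto simp: commutant_def fun_eq_iff)

lemma vna_comp: "A \<in> M \<Longrightarrow> B \<in> M \<Longrightarrow> (\<lambda>h. A (B h)) \<in> M"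
  by (simp add: vna_mem_iff bop_comp)

lemma vna_plus: "A \<in> M \<Longrightarrow> B \<in> M \<Longrightarrow> (\<lambda>h. A h + B h) \<in> M"
  by (auto simp: vna_mem_iff bop_plus bopD(1)[OF commutantD(1)])

lemma vna_minus: "A \<in> M \<Longrightarrow> B \<in> M \<Longrightarrow> (\<lambda>h. A h - B h) \<in> M"
  by (auto simp: vna_mem_iff bop_minus bopD(6)[OF commutantD(1)])

lemma vna_scaleR: "A \<in> M \<Longrightarrow> (\<lambda>h. r *\<^sub>R A h) \<in> M"
  by (auto simp: vna_mem_iff bop_scaleR bopD(3)[OF commutantD(1)])

lemma vna_rproj: assumes "A \<in> M" "selfadj A" shows "rproj A \<in> M"
  unfolding vna_mem_iff
proof (intro conjI ballI allI)
  show "bop (rproj A)" using rproj_spec(1) selfadj_bop assms(2) is_projD(2) by blast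
  show "C (rproj A h) = rproj A (C h)" if "C \<in> commutant M" for C h
    using rproj_commute[OF assms(2) commutantD(1)[OF that]] commutantD(2)[OF that assms(1)] by simp
qed

text \<open>The projection \<open>1 - r(a)\<close> onto the kernel of \<open>a\<close> lies in
  \<open>M\<close> and is the greatest projection annihilating \<open>a\<close>, so it equals
  \<open>n(a)\<close>.\<close>

lemma strict_in_kernel:
  assumes a: "a \<in> op_interval M id" and strict: "strict_in M a" and "a h = 0"
  shows "h = 0"
proof -
  have aM: "a \<in> M" and sa: "selfadj a"
    using a by (simp_all add: op_interval_def ole_zero_iff opos_selfadj)
  note r = rproj_spec(1)[OF selfadj_bop[OF sa]]
  let ?e = "\<lambda>h. h - rproj a h"
  have e: "is_proj ?e" by (rule is_proj_compl[OF r])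
  have eM: "?e \<in> projs M" using e vna_minus[OF vna_id vna_rproj[OF aM sa]] by (simp add: projs_def)
  have "psup M {q \<in> projs M. q \<circ> a = zero_op} = ?e"
  proof (rule psup_greatest[OF eM])
    show "?e \<in> {q \<in> projs M. q \<circ> a = zero_op}"
      using eM by (simp add: fun_eq_iff zero_op_def rproj_apply[OF selfadj_bop[OF sa]])
    fix q assume "q \<in> {q \<in> projs M. q \<circ> a = zero_op}"
    then have q: "is_proj q" and qa: "q (a h) = 0" for h
      by (auto simp: projs_def fun_eq_iff zero_op_def)
    have "rproj a (q h) = 0" for h
      unfolding rproj_eq_0_iff[OF selfadj_bop[OF sa]]
      by (simp add: is_projD(4)[OF q, symmetric] qa)
    then show "ole q ?e" by (intro ole_projI[OF q e]) simp
  qed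
  then have "?e = zero_op" using strict by (simp add: strict_in_def n_proj_def)
  then have "h = rproj a h" for h by (simp add: fun_eq_iff zero_op_def)
  then show "h = 0" using rproj_selfadj_eq_0_iff[OF sa] \<open>a h = 0\<close> by metis
qed

text \<open>The projection \<open>1 - r(1 - a)\<close> onto the fixed vectors of \<open>a\<close>
  lies in \<open>M\<close> and is the greatest projection below \<open>a\<close>, so it equals
  \<open>s(a)\<close>.\<close>

lemma strict_in_fixed:
  assumes a: "a \<in> op_interval M id" and strict: "strict_in M a" and "a h = h"
  shows "h = 0"
proof -
  let ?c = "\<lambda>h. h - a h"
  have aM: "a \<in> M" and pa: "opos a" and pc: "opos ?c" and le: "ole a id"
    using a unfolding op_interval_def ole_zero_iff mem_Collect_eq by (simp_all add: ole_def)
  note ba = selfadj_bop[OF opos_selfadj[OF pa]]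
  note sc = opos_selfadj[OF pc] and bc = selfadj_bop[OF opos_selfadj[OF pc]]
  note r = rproj_spec(1)[OF bc]
  let ?R = "rproj ?c"
  let ?e = "\<lambda>h. h - ?R h"
  have e: "is_proj ?e" by (rule is_proj_compl[OF r])
  have eM: "?e \<in> projs M"
    using e vna_minus[OF vna_id vna_rproj[OF vna_minus[OF vna_id aM] sc]] by (simp add: projs_def)
  have "?R (?e h) = 0" for h by (simp add: bopD[OF is_projD(2)[OF r]] is_projD(3)[OF r])
  then have ae: "a (?e h) = ?e h" for h
    using rproj_selfadj_eq_0_iff[OF sc, of "?e h"] by simp
  have aR: "a (?R h) = ?R (a h)" for h
    using rproj_commute[OF sc ba] by (simp add: bopD[OF ba])
  have "psup M {q \<in> projs M. ole q a} = ?e"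
  proof (rule psup_greatest[OF eM])
    \<comment> \<open>As \<open>a\<close> is the identity on the range of \<open>?e\<close> and
      commutes with \<open>?R\<close>, the difference is \<open>?R a ?R\<close>, which is
      positive.\<close>
    have "Re (cinner h (a h - ?e h)) \<ge> 0" for h
    proof -
      have "a h - ?e h = a (?R h)" using ae[of h] by (simp add: bopD[OF ba] algebra_simps)
      also have "\<dots> = ?R (a (?R h))" by (simp add: aR is_projD(3)[OF r])
      finally show ?thesis using oposD[OF pa, of "?R h"] by (simp add: is_projD(4)[OF r])
    qed
    moreover have "selfadj (\<lambda>h. a h - ?e h)"
      using opos_selfadj[OF pa] is_projD(2,4)[OF e]
      by (simp add: selfadj_def bop_minus[OF ba is_projD(2)[OF e]] cinner_diff_left cinner_diff_right)
    ultimately have "ole ?e a" by (simp add: ole_def ba is_projD(2)[OF e] oposI)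
    then show "?e \<in> {q \<in> projs M. ole q a}" using eM by simp
    fix q assume "q \<in> {q \<in> projs M. ole q a}"
    then have q: "is_proj q" and qa: "ole q a" by (auto simp: projs_def)
    \<comment> \<open>On the range of \<open>q\<close>, \<open>q \<le> a \<le> 1\<close> squeezes
      the form of \<open>1 - a\<close> to zero.\<close>
    have "?c (q h) = 0" for h
    proof (rule opos_form_eq_0[OF pc])
      have "Re (cinner (q h) (q h)) \<le> Re (cinner (q h) (a (q h)))"
        using ole_Re[OF qa, of "q h"] by (simp add: is_projD(3)[OF q])
      then show "Re (cinner (q h) (?c (q h))) = 0"
        using oposD[OF pc, of "q h"] by (simp add: cinner_diff_right)
    qed
    then have "?R (q h) = 0" for h by (simp add: rproj_selfadj_eq_0_iff[OF sc])
    then show "ole q ?e" by (intro ole_projI[OF q e]) simp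
  qed
  then have "?e = zero_op" using strict by (simp add: strict_in_def s_proj_def)
  then have "h = ?R h" for h by (simp add: fun_eq_iff zero_op_def)
  then show "h = 0" using rproj_selfadj_eq_0_iff[OF sc] \<open>a h = h\<close> by (metis right_minus_eq)
qed

lemma zero_in_corner: "is_proj p \<Longrightarrow> zero_op \<in> corner M p"
  using vna_minus[OF vna_id vna_id]
  by (auto simp: corner_def zero_op_def bopD[OF is_projD(2)] intro!: exI[of _ "\<lambda>_. 0"])

text \<open>A converse to the two preceding results: a projection of the corner has its range in
  \<open>pH\<close>. If it lies below \<open>A\<close>, its range consists of fixed vectors of
  \<open>A\<close>; if it annihilates \<open>A\<close>, of kernel vectors. So both suprema are taken
  over the zero projection alone.\<close>

lemma strict_in_cornerI:
  assumes p: "is_proj p" and A: "opos A" "ole A p"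
    and inj: "\<And>h. p h = h \<Longrightarrow> A h = 0 \<Longrightarrow> h = 0"
    and nofix: "\<And>h. p h = h \<Longrightarrow> A h = h \<Longrightarrow> h = 0"
  shows "strict_in (corner M p) A"
proof -
  have pq: "p (q h) = q h" if "q \<in> projs (corner M p)" for q h
    using that by (auto simp: projs_def corner_def is_projD(3)[OF p])
  have 0: "zero_op \<in> projs (corner M p)" by (simp add: projs_def is_proj_zero zero_in_corner[OF p])
  have "q = zero_op" if "q \<in> projs (corner M p)" "ole q A" for q
  proof
    fix h
    have q: "is_proj q" using that by (simp add: projs_def)
    let ?k = "q h"
    have pk: "p ?k = ?k" by (rule pq[OF that(1)])
    have "(\<lambda>h. p h - A h) ?k = 0"
    proof (rule opos_form_eq_0[where A = "\<lambda>h. p h - A h"])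
      show "opos (\<lambda>h. p h - A h)" using A(2) by (simp add: ole_def)
      show "Re (cinner ?k (p ?k - A ?k)) = 0"
        using ole_Re[OF that(2), of ?k] ole_Re[OF A(2), of ?k]
        by (simp add: is_projD(3)[OF q] pk cinner_diff_right)
    qed
    then show "q h = zero_op h" using nofix[OF pk] pk by (simp add: zero_op_def)
  qed
  then have s: "{q \<in> projs (corner M p). ole q A} = {zero_op}"
    using 0 A(1) by (auto simp: ole_zero_iff)
  have "q = zero_op" if "q \<in> projs (corner M p)" "q \<circ> A = zero_op" for q
  proof
    fix h
    have q: "is_proj q" using that by (simp add: projs_def)
    have "cinner k (A (q h)) = 0" for k
      using that(2) by (simp add: selfadjD[OF opos_selfadj[OF A(1)], symmetric]
          is_projD(4)[OF q, symmetric] fun_eq_iff zero_op_def)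
    then have "A (q h) = 0" by (metis cinner_self_eq_0)
    then show "q h = zero_op h" using inj[OF pq[OF that(1)]] by (simp add: zero_op_def)
  qed
  then have n: "{q \<in> projs (corner M p). q \<circ> A = zero_op} = {zero_op}"
    using 0 by (auto simp: zero_op_def fun_eq_iff)
  have "ole zero_op (zero_op :: 'a \<Rightarrow> 'a)" using is_projD(6)[OF is_proj_zero] by (simp add: ole_zero_iff)
  then have "psup (corner M p) {zero_op} = zero_op" by (intro psup_greatest[OF 0]) auto
  then show ?thesis by (simp add: strict_in_def s_proj_def n_proj_def s n)
qed

end

section \<open>Polar decomposition\<close>

lemma bop_eq_on_closure_range:
  assumes "bop C" "bop A" "bop B" "\<And>h. A (C h) = B (C h)"
  shows "A (rproj C x) = B (rproj C x)"
proof -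
  obtain f where f: "(\<lambda>n. C (f n)) \<longlonglongrightarrow> rproj C x" using rproj_approx[OF assms(1)] by blast
  show ?thesis
    using bop_tendsto[OF assms(2) f] bop_tendsto[OF assms(3) f] unfolding assms(4)
    by (rule LIMSEQ_unique)
qed

text \<open>Equal norms make \<open>C h \<mapsto> D h\<close> well defined and isometric on the
  range of \<open>C\<close>. It extends to the closure by completeness, and by zero to the
  complement through evaluation at \<open>rproj C x\<close>.\<close>

lemma isometric_intertwiner:
  fixes C D :: "'a::chilbert \<Rightarrow> 'a"
  assumes C: "bop C" and D: "bop D" and eq: "\<And>h. norm (C h) = norm (D h)"
  shows "\<exists>W. bop W \<and> (\<forall>h. W (C h) = D h) \<and> (\<forall>x. norm (W x) = norm (rproj C x))"
proof -
  \<comment> \<open>the closure of the graph of \<open>C h \<mapsto> D h\<close>\<close>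
  define G where "G u v \<longleftrightarrow> (\<exists>f. (\<lambda>n. C (f n)) \<longlonglongrightarrow> u \<and> (\<lambda>n. D (f n)) \<longlonglongrightarrow> v)" for u v
  have G_norm: "norm u = norm v" if G: "G u v" for u v
  proof -
    obtain f where f: "(\<lambda>n. C (f n)) \<longlonglongrightarrow> u" "(\<lambda>n. D (f n)) \<longlonglongrightarrow> v"
      using G unfolding G_def by blast
    show ?thesis
      using LIMSEQ_unique[OF tendsto_norm[OF f(1), unfolded eq] tendsto_norm[OF f(2)]] .
  qed
  have G_add: "G (u + u') (v + v')" if G: "G u v" "G u' v'" for u u' v v'
  proof -
    obtain f g where f: "(\<lambda>n. C (f n)) \<longlonglongrightarrow> u" "(\<lambda>n. D (f n)) \<longlonglongrightarrow> v"
      and g: "(\<lambda>n. C (g n)) \<longlonglongrightarrow> u'" "(\<lambda>n. D (g n)) \<longlonglongrightarrow> v'"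
      using G unfolding G_def by blast
    show ?thesis
      unfolding G_def using tendsto_add[OF f(1) g(1)] tendsto_add[OF f(2) g(2)]
      by (intro exI[of _ "\<lambda>n. f n + g n"]) (simp add: bopD[OF C] bopD[OF D])
  qed
  have G_scale: "G (cscale c u) (cscale c v)" if G: "G u v" for c u v
  proof -
    obtain f where f: "(\<lambda>n. C (f n)) \<longlonglongrightarrow> u" "(\<lambda>n. D (f n)) \<longlonglongrightarrow> v"
      using G unfolding G_def by blast
    show ?thesis
      unfolding G_def using bop_tendsto[OF bop_cscale f(1)] bop_tendsto[OF bop_cscale f(2)]
      by (intro exI[of _ "\<lambda>n. cscale c (f n)"]) (simp add: bopD[OF C] bopD[OF D])
  qed
  have G_fun: "v = v'" if "G u v" "G u v'" for u v v'
  proof -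
    have "G (u + cscale (-1) u) (v + cscale (-1) v')" by (intro G_add G_scale that)
    from G_norm[OF this] show ?thesis by simp
  qed
  have "\<exists>v. G (rproj C x) v" for x
  proof -
    obtain f where f: "(\<lambda>n. C (f n)) \<longlonglongrightarrow> rproj C x" using rproj_approx[OF C] by blast
    have "dist (D (f m)) (D (f n)) = dist (C (f m)) (C (f n))" for m n
      unfolding dist_norm by (metis bopD(6) C D eq)
    then have "Cauchy (\<lambda>n. D (f n))"
      using LIMSEQ_imp_Cauchy[OF f] unfolding Cauchy_def by simp
    then obtain v where "(\<lambda>n. D (f n)) \<longlonglongrightarrow> v" using Cauchy_convergent convergent_def by blast
    then show ?thesis using f G_def by blast
  qed
  then obtain W where W: "\<And>x. G (rproj C x) (W x)" by metis
  note r = rproj_spec(1)[OF C] and br = bopD[OF is_projD(2)[OF rproj_spec(1)[OF C]]]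
  have nW: "norm (W x) = norm (rproj C x)" for x using G_norm[OF W] by simp
  have "clinear_map W" unfolding clinear_map_def
  proof (intro conjI allI)
    fix x y c
    show "W (x + y) = W x + W y" using G_fun[OF W[of "x + y"]] G_add[OF W W, of x y] by (simp add: br)
    show "W (cscale c x) = cscale c (W x)"
      using G_fun[OF W[of "cscale c x"]] G_scale[OF W, of c x] by (simp add: br)
  qed
  then have "bop W" unfolding bop_def using is_projD(7)[OF r] nW by (metis mult_1)
  moreover have "W (C h) = D h" for h
  proof (rule G_fun)
    show "G (C h) (W (C h))" using W[of "C h"] by (simp add: rproj_apply[OF C])
    show "G (C h) (D h)" unfolding G_def by (intro exI[of _ "\<lambda>_. h"]) simp
  qed
  ultimately show ?thesis using nW by blast
qed

text \<open>With \<open>C\<close> the modulus of \<open>D\<close> this is the polar decomposition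
  \<open>D = W C\<close>. The hypothesis is symmetric in \<open>C\<close> and \<open>D\<close>, so
  exchanging them produces the inverse partial isometry \<open>V\<close>.\<close>

lemma partial_isometry_exists:
  fixes C D :: "'a::chilbert \<Rightarrow> 'a"
  assumes C: "bop C" and D: "bop D" and eq: "\<And>h. norm (C h) = norm (D h)"
  obtains W V where "bop W" "bop V" "\<And>h. W (C h) = D h"
    "\<And>x. norm (W x) = norm (rproj C x)" "\<And>x. V (W x) = rproj C x" "\<And>x. W (V x) = rproj D x"
    "\<And>x. rproj D (W x) = W x" "\<And>x. rproj C (V x) = V x"
proof -
  obtain W where W: "bop W" "\<And>h. W (C h) = D h" "\<And>x. norm (W x) = norm (rproj C x)"
    using isometric_intertwiner[OF C D eq] by blast
  obtain V where V: "bop V" "\<And>h. V (D h) = C h" "\<And>x. norm (V x) = norm (rproj D x)"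
    using isometric_intertwiner[OF D C eq[symmetric]] by blast
  have absorb: "T (rproj E x) = T x"
    if "bop E" "bop T" "\<And>x. norm (T x) = norm (rproj E x)" for E T :: "'a \<Rightarrow> 'a" and x
  proof -
    have "norm (T (x - rproj E x)) = 0"
      unfolding that(3) using rproj_spec(1)[OF that(1)] by (simp add: bopD is_projD(2,3))
    then show ?thesis by (simp add: bopD[OF that(2)])
  qed
  have WR: "W (rproj C x) = W x" for x by (rule absorb[OF C W(1,3)])
  have VR: "V (rproj D x) = V x" for x by (rule absorb[OF D V(1,3)])
  note bC = is_projD(2)[OF rproj_spec(1)[OF C]] and bD = is_projD(2)[OF rproj_spec(1)[OF D]]
  have VW: "V (W x) = rproj C x" for x
    using bop_eq_on_closure_range[OF C bop_comp[OF V(1) W(1)] bop_id, of x]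
    by (simp add: W(2) V(2) WR)
  have WV: "W (V x) = rproj D x" for x
    using bop_eq_on_closure_range[OF D bop_comp[OF W(1) V(1)] bop_id, of x]
    by (simp add: W(2) V(2) VR)
  have "rproj D (W x) = W x" for x
    using bop_eq_on_closure_range[OF C bop_comp[OF bD W(1)] W(1), of x]
    by (simp add: W(2) rproj_apply[OF D] WR)
  moreover have "rproj C (V x) = V x" for x
    using bop_eq_on_closure_range[OF D bop_comp[OF bC V(1)] V(1), of x]
    by (simp add: V(2) rproj_apply[OF C] VR)
  ultimately show ?thesis using that W V VW WV by blast
qed

section \<open>Absolutely compatible pairs\<close>

lemma opos_plus: "opos A \<Longrightarrow> opos B \<Longrightarrow> opos (\<lambda>h. A h + B h)"
  by (simp add: opos_def bop_plus cinner_simps)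

lemma
  assumes x: "selfadj x" and contr: "\<And>h. norm (x h) \<le> norm h"
  shows oabs_opos: "opos (oabs x)"
    and oabs_square: "oabs x (oabs x h) = x (x h)"
    and oabs_commute: "x (oabs x h) = oabs x (x h)"
proof -
  have eq: "oabs x = osqrt (\<lambda>h. x (x h))"
    using adj_eqI[of x x] selfadjD[OF x] by (simp add: oabs_def o_def)
  note bx = selfadj_bop[OF x]
  have form: "cinner h (x (x h)) = complex_of_real ((norm (x h))\<^sup>2)" for h
    by (simp add: selfadjD[OF x, symmetric] cinner_self del: of_real_power)
  have pos: "opos (\<lambda>h. x (x h))"
    by (simp add: opos_def form bop_comp bx del: of_real_power)
  have "opos (\<lambda>h. h - x (x h))"
    using contr by (simp add: opos_def form bop_comp bop_minus bop_id bx cinner_diff_right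
        cinner_self power_mono del: of_real_power)
  then have le: "ole (\<lambda>_. 0) (\<lambda>h. x (x h))" "ole (\<lambda>h. x (x h)) id"
    using pos bop_comp[OF bx bx] by (simp_all add: ole_def bop_zero bop_id id_def)
  show "opos (oabs x)" "oabs x (oabs x h) = x (x h)" "x (oabs x h) = oabs x (x h)"
    using osqrt_opos[OF le] osqrt_square[OF le] osqrt_commute[OF le bx] by (simp_all add: eq)
qed

lemma abs_compat_modulus:
  fixes a b :: "'a::chilbert \<Rightarrow> 'a"
  assumes T_def: "T = (\<lambda>h. a h + b h - a (b h) - b (a h))"
    and a: "opos a" "opos (\<lambda>h. h - a h)" and b: "opos b" "opos (\<lambda>h. h - b h)"
    and compat: "abs_compat a b"
  shows "opos T" "opos (\<lambda>h. h - T h)" "a (T h) = T (a h)" "b (T h) = T (b h)"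
    "T (T h) = a (a h - b h) - b (a h - b h)"
proof -
  let ?x = "\<lambda>k. a k - b k" and ?y = "\<lambda>k. k - a k - b k"
  note sa = opos_selfadj[OF a(1)] and sb = opos_selfadj[OF b(1)]
  note ba = selfadj_bop[OF sa] and bb = selfadj_bop[OF sb]
  note lin = bopD[OF ba] bopD[OF bb]
  have sx: "selfadj ?x" and sy: "selfadj ?y"
    using sa sb by (simp_all add: selfadj_def bop_intros cinner_simps)
  have "opos (\<lambda>h. h - ?x h)" using opos_plus[OF a(2) b(1)] by (simp add: algebra_simps)
  moreover have "opos (\<lambda>h. h + ?x h)" using opos_plus[OF b(2) a(1)] by (simp add: algebra_simps)
  ultimately have cx: "norm (?x h) \<le> norm h" for h by (rule selfadj_contraction[OF sx])
  have "opos (\<lambda>h. h - ?y h)" using opos_plus[OF a(1) b(1)] by (simp add: algebra_simps)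
  moreover have "opos (\<lambda>h. h + ?y h)" using opos_plus[OF a(2) b(2)] by (simp add: algebra_simps)
  ultimately have cy: "norm (?y h) \<le> norm h" for h by (rule selfadj_contraction[OF sy])
  let ?X = "oabs ?x" and ?Y = "oabs ?y"
  note X = oabs_opos[OF sx cx] oabs_square[OF sx cx] oabs_commute[OF sx cx]
  note Y = oabs_opos[OF sy cy] oabs_square[OF sy cy] oabs_commute[OF sy cy]
  note linX = bopD[OF selfadj_bop[OF opos_selfadj[OF X(1)]]]
  have XY: "?Y h = h - ?X h" for h
    using compat by (simp add: abs_compat_def fun_eq_iff algebra_simps)
  have T: "?X h = T h" for h
  proof -
    \<comment> \<open>Subtracting \<open>|x|^2 = x^2\<close> from \<open>(1 - |x|)^2 = y^2\<close>
      leaves \<open>2 |x| = 1 + x^2 - y^2\<close>, where the squares of \<open>a\<close> and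
      \<open>b\<close> cancel.\<close>
    have "?Y (?Y h) = h - 2 *\<^sub>R ?X h + ?X (?X h)"
      by (simp add: XY linX scaleR_2)
    then have "2 *\<^sub>R ?X h = h + ?X (?X h) - ?Y (?Y h)" by simp
    also have "\<dots> = h + ?x (?x h) - ?y (?y h)" by (simp only: X(2) Y(2))
    also have "\<dots> = 2 *\<^sub>R T h"
      by (simp add: T_def lin scaleR_2 algebra_simps)
    finally show ?thesis by simp
  qed
  then have XT: "?X = T" by auto
  show "opos T" using X(1) by (simp add: XT)
  have YT: "?Y = (\<lambda>h. h - T h)" using XY by (simp add: fun_eq_iff XT)
  show "opos (\<lambda>h. h - T h)" using Y(1) by (simp only: YT)
  note linT = linX[unfolded XT]
  have x: "a (T h) - b (T h) = T (a h) - T (b h)" for h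
    using X(3)[of h] by (simp add: XT linT)
  have y: "a (T h) + b (T h) = T (a h) + T (b h)" for h
    using Y(3)[of h, unfolded YT] by (simp add: linT lin algebra_simps)
  have "2 *\<^sub>R a (T h) = (a (T h) - b (T h)) + (a (T h) + b (T h))" by (simp add: scaleR_2)
  also have "\<dots> = 2 *\<^sub>R T (a h)" unfolding x y by (simp add: scaleR_2)
  finally show "a (T h) = T (a h)" by simp
  have "2 *\<^sub>R b (T h) = (a (T h) + b (T h)) - (a (T h) - b (T h))" by (simp add: scaleR_2)
  also have "\<dots> = 2 *\<^sub>R T (b h)" unfolding x y by (simp add: scaleR_2)
  finally show "b (T h) = T (b h)" by simp
  show "T (T h) = a (a h - b h) - b (a h - b h)"
    using X(2)[of h] by (simp add: XT)
qed

text \<open>What remains of the hypotheses once \<open>M\<close> is left behind. Strictness survives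
  as the four conditions on kernels and fixed vectors; \<open>on_p\<close> and \<open>on_q\<close>
  say that \<open>j\<close> is 0 on \<open>pH\<close> and \<open>1 - T\<close> on its
  complement.\<close>

locale compat_pair =
  fixes a b T p :: "'a::chilbert \<Rightarrow> 'a"
  assumes a_pos: "opos a" and a_le: "opos (\<lambda>h. h - a h)"
    and b_pos: "opos b" and b_le: "opos (\<lambda>h. h - b h)"
    and a_inj: "a h = 0 \<Longrightarrow> h = 0" and a_nofix: "a h = h \<Longrightarrow> h = 0"
    and b_inj: "b h = 0 \<Longrightarrow> h = 0" and b_nofix: "b h = h \<Longrightarrow> h = 0"
    and T_bop: "bop T" and T_le: "opos (\<lambda>h. h - T h)"
    and p_proj: "is_proj p"
    and T_a: "T (a h) = a (T h)" and T_b: "T (b h) = b (T h)" and T_p: "T (p h) = p (T h)"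
    and jordan_eq: "a (b h) + b (a h) = a h + b h - T h"
    and on_p: "p h = h \<Longrightarrow> a h + b h = T h"
    and on_q: "p h = 0 \<Longrightarrow> a h + b h = 2 *\<^sub>R h - T h"
begin

text \<open>The hypotheses are symmetric, so every fact about \<open>a\<close> below is also available for \<open>b\<close>.\<close>

lemma swap: "compat_pair b a T p"
proof
  fix h
  show "b (a h) + a (b h) = b h + a h - T h"
    using jordan_eq[of h] by (simp only: add.commute)
  show "b h + a h = T h" if "p h = h" using on_p[OF that] by (simp only: add.commute)
  show "b h + a h = 2 *\<^sub>R h - T h" if "p h = 0" using on_q[OF that] by (simp only: add.commute)
qed (fact a_pos a_le b_pos b_le a_inj a_nofix b_inj b_nofix T_bop T_le p_proj T_a T_b T_p)+

lemma a_bop: "bop a" and b_bop: "bop b" and p_bop: "bop p" and sa_a: "selfadj a"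
  using a_pos b_pos p_proj by (auto simp: opos_def is_projD(2) opos_selfadj)

lemmas lin = bopD[OF a_bop] bopD[OF b_bop] bopD[OF p_bop] bopD[OF T_bop]

lemmas pp = is_projD(3)[OF p_proj]

lemma b_on_p: "p h = h \<Longrightarrow> b h = T h - a h"
  using on_p by (metis add_diff_cancel_left')

lemma b_on_q: "p h = 0 \<Longrightarrow> b h = 2 *\<^sub>R h - T h - a h"
  using on_q by (metis add_diff_cancel_left')

text \<open>On \<open>pH\<close> the anticommutator \<open>a b + b a\<close> vanishes. Replacing
  \<open>b\<close> by \<open>T - a\<close> on \<open>pH\<close> and by \<open>2 - T - a\<close> on
  the complement leaves an equation for \<open>a^2\<close>. Its two components give the upper and
  the lower identity that follow.\<close>

lemma square_on_p:
  assumes h: "p h = h"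
  shows "a (a h) = T (p (a h)) + (a h - p (a h))"
proof -
  let ?u = "p (a h)" and ?v = "a h - p (a h)"
  have "a (b h) + b (a h) = 0" using jordan_eq[of h] on_p[OF h] by simp
  moreover have "a (b h) = T (a h) - a (a h)" by (simp add: b_on_p[OF h] lin T_a)
  moreover have "b (a h) = T (a h) - a (a h) + 2 *\<^sub>R ?v - 2 *\<^sub>R T ?v"
  proof -
    have "b (a h) = b ?u + b ?v" by (simp add: lin)
    also have "b ?u = T ?u - a ?u" by (rule b_on_p) (simp add: pp)
    also have "b ?v = 2 *\<^sub>R ?v - T ?v - a ?v" by (rule b_on_q) (simp add: lin pp)
    finally show ?thesis by (simp add: lin scaleR_2 algebra_simps)
  qed
  ultimately have "2 *\<^sub>R (a (a h)) = 2 *\<^sub>R (T (a h) + ?v - T ?v)"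
    by (simp add: scaleR_2 algebra_simps)
  then have "a (a h) = T (a h) + ?v - T ?v" by simp
  then show ?thesis by (simp add: lin)
qed

lemma compress_square: "p (a (a (p h))) = T (p (a (p h)))"
proof -
  have "p (a (a (p h))) = p (T (p (a (p h))) + (a (p h) - p (a (p h))))"
    by (rule arg_cong[OF square_on_p[OF pp]])
  also have "\<dots> = T (p (a (p h)))" by (simp add: lin pp T_p[symmetric])
  finally show ?thesis .
qed

lemma off_diagonal_square: "a (a (p h)) - p (a (a (p h))) = a (p h) - p (a (p h))"
  unfolding compress_square by (simp add: square_on_p[OF pp])

text \<open>\<open>T\<close> commutes with \<open>a\<close>, so \<open>T\<close> fixes
  \<open>a h\<close> too; the formula for \<open>a^2\<close> then makes \<open>a h\<close> a fixed
  vector of \<open>a\<close>.\<close>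

lemma one_minus_T_inj:
  assumes h: "p h = h" and T: "T h = h" shows "h = 0"
proof -
  have Ta: "T (a h) = a h" by (simp add: T_a T)
  then have "a (a h) = a h" using square_on_p[OF h] by (simp add: T_p Ta)
  then have "a h = 0" by (rule a_nofix)
  then show ?thesis by (rule a_inj)
qed

lemma compress_inj: assumes h: "p h = h" and "p (a h) = 0" shows "h = 0"
proof -
  have "cinner h (a h) = 0" by (metis assms cinner_zero_right is_projD(4)[OF p_proj])
  then have "a h = 0" by (intro opos_form_eq_0[OF a_pos]) simp
  then show ?thesis by (rule a_inj)
qed

lemma compress_nofix: assumes h: "p h = h" and fixed: "p (a h) = h" shows "h = 0"
proof -
  have "cinner h (a h) = cinner h h" by (metis assms is_projD(4)[OF p_proj])
  then have "h - a h = 0" by (intro opos_form_eq_0[OF a_le]) (simp add: cinner_simps)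
  then show ?thesis using a_nofix[of h] by simp
qed

text \<open>Both \<open>h\<close> and \<open>a h\<close> lie in the complement, where
  \<open>b = 2 - T - a\<close>. The Jordan relation then makes \<open>h - a h\<close> a fixed vector
  of \<open>b\<close>, so it vanishes and \<open>h\<close> is a fixed vector of
  \<open>a\<close>.\<close>

lemma corner_inj: assumes h: "p h = 0" and pa: "p (a h) = 0" shows "h = 0"
proof -
  let ?k = "h - a h"
  have pk: "p ?k = 0" by (simp add: lin assms)
  have "a (b h) + b (a h) = 2 *\<^sub>R h - 2 *\<^sub>R T h"
    using jordan_eq[of h] on_q[OF h] by (simp add: scaleR_2 algebra_simps)
  moreover have "a (b h) = 2 *\<^sub>R a h - T (a h) - a (a h)" by (simp add: b_on_q[OF h] lin T_a)
  moreover have "b (a h) = 2 *\<^sub>R a h - T (a h) - a (a h)" by (rule b_on_q[OF pa])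
  ultimately have "2 *\<^sub>R (2 *\<^sub>R a h - T (a h) - a (a h)) = 2 *\<^sub>R (h - T h)"
    by (simp add: scaleR_2 algebra_simps)
  then have *: "2 *\<^sub>R a h - T (a h) - a (a h) = h - T h" by simp
  have "b ?k = 2 *\<^sub>R ?k - T ?k - a ?k" by (rule b_on_q[OF pk])
  also have "\<dots> = ?k" using * by (simp add: lin scaleR_2 algebra_simps)
  finally have "b ?k = ?k" .
  then have "?k = 0" by (rule b_nofix)
  then show ?thesis using a_nofix[of h] by simp
qed

end

section \<open>Block form\<close>

lemma proj_eq_of_kernel:
  assumes P: "is_proj P" and Q: "is_proj Q" and ker: "\<And>x. P x = 0 \<longleftrightarrow> Q x = 0" shows "P = Q"
proof (intro ext cinner_ext)
  fix x y
  have QP: "Q (P y) = Q y" for y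
    using ker[of "y - P y"] by (simp add: bopD[OF is_projD(2)[OF P]] bopD[OF is_projD(2)[OF Q]] is_projD(3)[OF P])
  have PQ: "P (Q x) = P x"
    using ker[of "x - Q x"] by (simp add: bopD[OF is_projD(2)[OF P]] bopD[OF is_projD(2)[OF Q]] is_projD(3)[OF Q])
  have "cinner y (P x) = cinner (P y) (Q x)" by (simp add: PQ is_projD(4)[OF P])
  also have "\<dots> = cinner (Q (P y)) x" by (simp add: is_projD(4)[OF Q])
  also have "\<dots> = cinner y (Q x)" by (simp add: QP is_projD(4)[OF Q])
  finally show "cinner y (P x) = cinner y (Q x)" .
qed

lemma cinner_eq_of_norm_eq:
  assumes V: "bop V" and R: "bop R" and eq: "\<And>x. norm (V x) = norm (R x)"
  shows "cinner (V x) (V y) = cinner (R x) (R y)"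
proof -
  have re: "Re (cinner (V x) (V y)) = Re (cinner (R x) (R y))" for x y
    using norm_add_squared[of "V x" "V y"] norm_add_squared[of "R x" "R y"] eq[of "x + y"]
    by (simp add: bopD[OF V] bopD[OF R] eq)
  show ?thesis
    using re[of x y] re[of x "cscale \<i> y"]
    by (simp add: complex_eq_iff bopD[OF V] bopD[OF R] cinner_scale_right)
qed

text \<open>Serves \<open>a\<close> with \<open>s = 1\<close> and \<open>b\<close> with
  \<open>s = -1\<close>; \<open>C\<close> is the common modulus and \<open>D\<close> the lower
  off-diagonal entry of \<open>a\<close>. Each entry involving \<open>W\<close> is computed on the
  range of \<open>C\<close> and extended to all of \<open>pH\<close>, the closure of that
  range.\<close>

lemma block_entries:
  assumes p: "is_proj p" and c: "bop c" and C: "bop C" and W: "bop W" and V: "bop V"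
    and rC: "rproj C = p" and Cp: "\<And>k. C (p k) = C k"
    and WC: "\<And>k. W (C k) = D k" and VW: "\<And>x. V (W x) = p x" and WV: "\<And>x. W (V x) = x - p x"
    and pV: "\<And>x. p (V x) = V x"
    and lower: "\<And>k. c (p k) - p (c (p k)) = s *\<^sub>R D k"
    and upper: "\<And>k. p (c (D k)) = s *\<^sub>R C (C k)"
    and corner: "\<And>k. c (D k) - p (c (D k)) = D k - D (p (c (p k)))"
    and comm: "\<And>k. C (p (c (p k))) = p (c (p (C k)))"
  shows "p (c h) = p (c (p (p h))) + s *\<^sub>R C (V h)"
    and "V (c h) = s *\<^sub>R C (p h) + (p (V h) - p (c (p (V h))))"
proof -
  note bp = is_projD(2)[OF p] and pp = is_projD(3)[OF p]
  note lin = bopD[OF bp] bopD[OF c] bopD[OF C] bopD[OF W] bopD[OF V]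
  have pC: "p (C k) = C k" for k using rproj_apply[OF C] by (simp add: rC)
  have VD: "V (D k) = C k" for k by (metis WC VW pC)
  have Vq: "V (x - p x) = V x" for x by (metis WV VW pV)
  have h: "c h = c (p h) + c (W (V h))" by (simp add: WV lin)
  have "p (c (W (rproj C (V h)))) = s *\<^sub>R C (rproj C (V h))"
    by (rule bop_eq_on_closure_range[OF C bop_comp[OF bp bop_comp[OF c W]] bop_scaleR[OF C]])
      (simp add: WC upper)
  then have 1: "p (c (W (V h))) = s *\<^sub>R C (V h)" by (simp add: rC pV)
  show "p (c h) = p (c (p (p h))) + s *\<^sub>R C (V h)" by (simp add: h lin(1-12) 1 pp)
  have *: "V (c (W (C k))) = C k - p (c (p (C k)))" for k
  proof -
    have "V (c (W (C k))) = V (c (D k) - p (c (D k)))" by (simp only: WC Vq)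
    also have "\<dots> = C k - C (p (c (p k)))" by (simp only: corner lin VD)
    finally show ?thesis by (simp only: comm)
  qed
  have "V (c (W (rproj C (V h)))) = rproj C (V h) - p (c (p (rproj C (V h))))"
    by (rule bop_eq_on_closure_range[OF C bop_comp[OF V bop_comp[OF c W]]
          bop_minus[OF bop_id bop_comp[OF bp bop_comp[OF c bp]]] *])
  then have 2: "V (c (W (V h))) = V h - p (c (p (V h)))" by (simp add: rC pV)
  have "V (c (p h)) = V (s *\<^sub>R D h)" by (simp only: lower[symmetric] Vq)
  then have 3: "V (c (p h)) = s *\<^sub>R C (p h)" by (simp add: lin VD Cp)
  show "V (c h) = s *\<^sub>R C (p h) + (p (V h) - p (c (p (V h))))"
    unfolding h lin 2 3 pV by simp
qed

lemma kk_unitaryI: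
  assumes p: "is_proj p" and V: "bop V" and W: "bop W"
    and nV: "\<And>x. norm (V x) = norm (x - p x)"
    and VW: "\<And>x. V (W x) = p x" and WV: "\<And>x. W (V x) = x - p x"
    and pV: "\<And>x. p (V x) = V x" and pW: "\<And>x. p (W x) = 0"
  shows "kk_unitary p (\<lambda>h. (p h, V h))"
proof -
  note bp = is_projD(2)[OF p] and pp = is_projD(3)[OF p]
  have Vp: "V (p x) = 0" for x using nV[of "p x"] by (simp add: pp)
  have "bij_betw (\<lambda>h. (p h, V h)) UNIV (range p \<times> range p)"
  proof (rule bij_betwI[where g = "\<lambda>(x, y). x + W y"])
    show "(\<lambda>h. (p h, V h)) \<in> UNIV \<rightarrow> range p \<times> range p"
      using pV by (auto simp: proj_range_iff[OF p] pp)
  qed (auto simp: WV VW Vp pp pW bopD[OF bp] bopD[OF V])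
  moreover have "cinner (p x) (p y) + cinner (V x) (V y) = cinner x y" for x y
    using cinner_eq_of_norm_eq[OF V bop_minus[OF bop_id bp] nV, of x y]
    by (simp add: cinner_simps is_projD(4)[OF p] pp bopD[OF bp])
  ultimately show ?thesis
    by (simp add: kk_unitary_def bopD[OF bp] bopD[OF V])
qed

section \<open>The compressions, their root and the unitary\<close>

context compat_pair
begin

lemma compress_b: "p (b (p h)) = T (p h) - p (a (p h))"
  by (simp add: b_on_p[OF pp] lin pp T_p[symmetric])

lemma off_diagonal_b: "b (p h) - p (b (p h)) = - (a (p h) - p (a (p h)))"
  by (simp add: b_on_p[OF pp] lin pp T_p[symmetric])

text \<open>On \<open>pH\<close> the compression of \<open>b\<close> is \<open>T\<close> minus that
  of \<open>a\<close>, and \<open>T\<close> commutes with both \<open>a\<close> and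
  \<open>p\<close>.\<close>

lemma compress_commute: "p (a (p (b (p h)))) = p (b (p (a (p h))))"
proof -
  have "p (a (p (b (p h)))) = T (p (a (p h))) - p (a (p (a (p h))))"
    by (simp only: compress_b lin T_a[symmetric] T_p[symmetric])
  moreover have "p (b (p (a (p h)))) = T (p (a (p h))) - p (a (p (a (p h))))"
    by (simp only: compress_b[of "a (p h)"] pp)
  ultimately show ?thesis by simp
qed

lemma off_diagonal_product:
  "p (a (a (p h) - p (a (p h)))) = p (a (p (b (p h))))"
  by (simp only: lin compress_square compress_commute compress_b[of "a (p h)"] pp)

text \<open>One identity with two uses: the product of the compressions is positive, and its root
  has the same norms as the off-diagonal entry.\<close>

lemma off_diagonal_form:
  "cinner h (p (a (p (b (p h))))) = complex_of_real ((norm (a (p h) - p (a (p h))))\<^sup>2)"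
proof -
  let ?d = "a (p h) - p (a (p h))"
  have "p ?d = 0" by (simp add: lin pp)
  then have "cinner (p (a (p h))) ?d = 0" by (simp only: is_projD(4)[OF p_proj] cinner_zero_right)
  then have "cinner ?d ?d = cinner (a (p h)) ?d" by (simp only: cinner_diff_left diff_zero)
  also have "\<dots> = cinner h (p (a ?d))"
    by (simp only: selfadjD[OF sa_a] is_projD(4)[OF p_proj])
  finally show ?thesis by (simp only: off_diagonal_product cinner_self)
qed

text \<open>
  In the notation of the theorem these are \<open>a\<^sub>1\<close> and \<open>b\<^sub>1\<close>, and \<open>od\<close> is the lower
  off-diagonal entry of \<open>a\<close>; the one of \<open>b\<close> is \<open>- od\<close>.
\<close>

abbreviation "ca \<equiv> \<lambda>h. p (a (p h))"
abbreviation "cb \<equiv> \<lambda>h. p (b (p h))"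
abbreviation "od \<equiv> \<lambda>h. a (p h) - p (a (p h))"

lemma bop_ca: "bop ca" and bop_cb: "bop cb" and bop_od: "bop od"
proof -
  show ca: "bop ca" by (rule bop_comp[OF p_bop bop_comp[OF a_bop p_bop]])
  show "bop cb" by (rule bop_comp[OF p_bop bop_comp[OF b_bop p_bop]])
  show "bop od" by (rule bop_minus[OF bop_comp[OF a_bop p_bop] ca])
qed

lemma form_ca: "cinner h (ca h) = cinner (p h) (a (p h))"
  by (simp add: is_projD(4)[OF p_proj])

lemma opos_ca: "opos ca" and ca_le: "ole ca p"
proof -
  have "Im (cinner (p h) (a (p h))) = 0 \<and> 0 \<le> Re (cinner (p h) (a (p h)))" for h
    using a_pos unfolding opos_def by blast
  then show "opos ca" unfolding opos_def form_ca using bop_ca by blast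
  have form: "cinner h (p h - ca h) = cinner (p h) (p h - a (p h))" for h
    unfolding is_projD(4)[OF p_proj] lin pp ..
  have "Im (cinner (p h) (p h - a (p h))) = 0 \<and> 0 \<le> Re (cinner (p h) (p h - a (p h)))" for h
    using a_le unfolding opos_def by blast
  then have "opos (\<lambda>h. p h - ca h)"
    unfolding opos_def form using bop_minus[OF p_bop bop_ca] by blast
  then show "ole ca p" using bop_ca p_bop by (simp only: ole_def)
qed

lemma od_contraction: "norm (od h) \<le> norm h"
proof -
  have "norm (od h) \<le> norm (a (p h))"
    by (rule is_projD(7)[OF is_proj_compl[OF p_proj]])
  also have "\<dots> \<le> norm (p h)"
    using a_pos a_le a_bop by (intro opos_contraction) (simp_all add: ole_def bop_zero bop_id id_def)
  also have "\<dots> \<le> norm h" by (rule is_projD(7)[OF p_proj])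
  finally show ?thesis .
qed

lemma product_form: "cinner h (ca (cb h)) = complex_of_real ((norm (od h))\<^sup>2)"
  using off_diagonal_form by (simp only: pp)

lemma product_pos: "ole (\<lambda>_. 0) (ca \<circ> cb)" and product_le: "ole (ca \<circ> cb) id"
proof -
  have bop: "bop (\<lambda>h. ca (cb h))" by (rule bop_comp[OF bop_ca bop_cb])
  then have "opos (\<lambda>h. ca (cb h))" by (simp only: opos_def product_form) simp
  then show "ole (\<lambda>_. 0) (ca \<circ> cb)" using bop by (simp add: ole_def o_def bop_zero)
  have "opos (\<lambda>h. h - ca (cb h))"
    unfolding opos_def cinner_diff_right product_form cinner_self
    using bop_minus[OF bop_id bop] power_mono[OF od_contraction norm_ge_zero, of _ 2]
    by (simp del: of_real_power)
  then show "ole (ca \<circ> cb) id" using bop bop_id by (simp only: ole_def o_def id_def)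
qed

definition cs :: "'a \<Rightarrow> 'a" where "cs = osqrt (ca \<circ> cb)"

lemma cs_pos: "opos cs"
  unfolding cs_def by (rule osqrt_opos[OF product_pos product_le])

lemma cs_bop: "bop cs" using cs_pos by (simp add: opos_def)

lemma cs_square: "cs (cs h) = ca (cb h)"
  unfolding cs_def osqrt_square[OF product_pos product_le] by simp

lemma norm_cs: "norm (cs h) = norm (od h)"
proof -
  have "cinner (cs h) (cs h) = cinner h (ca (cb h))"
    by (simp only: selfadjD[OF opos_selfadj[OF cs_pos]] cs_square)
  then have "complex_of_real ((norm (cs h))\<^sup>2) = complex_of_real ((norm (od h))\<^sup>2)"
    by (simp only: product_form cinner_self)
  then show ?thesis by (simp only: of_real_eq_iff) simp
qed

lemma cs_ca: "cs (ca h) = ca (cs h)" and cs_cb: "cs (cb h) = cb (cs h)" and cs_p: "cs (p h) = cs h"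
proof -
  show "cs (ca h) = ca (cs h)"
    unfolding cs_def by (rule osqrt_commute[OF product_pos product_le bop_ca, symmetric])
      (simp add: pp compress_commute)
  show "cs (cb h) = cb (cs h)"
    unfolding cs_def by (rule osqrt_commute[OF product_pos product_le bop_cb, symmetric])
      (simp add: pp compress_commute)
  have "norm (cs (h - p h)) = 0" unfolding norm_cs by (simp add: lin pp)
  then show "cs (p h) = cs h" by (simp add: bopD[OF cs_bop])
qed

text \<open>A kernel vector of the root is killed by \<open>ca \<circ> cb\<close>, and both
  compressions are injective on \<open>pH\<close>.\<close>

lemma cs_range_proj: "rproj cs = p"
proof (rule proj_eq_of_kernel[OF rproj_spec(1)[OF cs_bop] p_proj])
  fix h
  have "p h = 0" if "cs h = 0"
  proof (rule compat_pair.compress_inj[OF swap])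
    have "ca (cb h) = 0" using cs_square[of h] by (simp add: that bopD(4)[OF cs_bop])
    then show "p (b (p h)) = 0" using compress_inj[of "cb h"] by (simp add: pp)
  qed (rule pp)
  moreover have "cs h = 0" if "p h = 0" using cs_p[of h] that by (simp add: bopD[OF cs_bop])
  ultimately show "rproj cs h = 0 \<longleftrightarrow> p h = 0"
    using rproj_selfadj_eq_0_iff[OF opos_selfadj[OF cs_pos]] by blast
qed

text \<open>The range is dense in the complement because the adjoint, \<open>p a (1 - p)\<close>, is
  injective there by \<open>corner_inj\<close>.\<close>

lemma od_range_proj: "rproj od = (\<lambda>h. h - p h)"
proof (rule proj_eq_of_kernel[OF rproj_spec(1)[OF bop_od] is_proj_compl[OF p_proj]])
  fix h
  have adj: "cinner (od k) h = cinner k (p (a (h - p h)))" for k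
    by (simp add: cinner_simps lin is_projD(4)[OF p_proj] selfadjD[OF sa_a])
  have "rproj od h = 0 \<longleftrightarrow> p (a (h - p h)) = 0"
    unfolding rproj_eq_0_iff[OF bop_od] adj by (metis cinner_self_eq_0 cinner_zero_right)
  also have "\<dots> \<longleftrightarrow> h - p h = 0"
    using corner_inj[of "h - p h"] by (auto simp: lin pp)
  finally show "rproj od h = 0 \<longleftrightarrow> h - p h = 0" .
qed

lemma block_decomposition:
  obtains W V where "bop W" "\<And>x. norm (W x) = norm (p x)" "\<And>x. V (W x) = p x"
    "\<And>x. W (V x) = x - p x" "kk_unitary p (\<lambda>h. (p h, V h))"
    "\<And>x. p (W x) = 0"
    "\<And>h. p (a h) = ca (p h) + cs (V h)" "\<And>h. V (a h) = cs (p h) + (p (V h) - ca (V h))"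
    "\<And>h. p (b h) = cb (p h) - cs (V h)" "\<And>h. V (b h) = - cs (p h) + (p (V h) - cb (V h))"
proof -
  \<comment> \<open>The polar decomposition of \<open>od\<close> with modulus \<open>cs\<close>; the
    two range projections identify its initial space as \<open>pH\<close> and its final space as the
    complement.\<close>
  obtain W V where W: "bop W" and V: "bop V" and WC: "\<And>h. W (cs h) = od h"
    and nW: "\<And>x. norm (W x) = norm (p x)" and VW: "\<And>x. V (W x) = p x"
    and WV: "\<And>x. W (V x) = x - p x" and "\<And>x. W x - p (W x) = W x" and pV: "\<And>x. p (V x) = V x"
    by (rule partial_isometry_exists[OF cs_bop bop_od norm_cs]) (simp add: cs_range_proj od_range_proj)
  then have pW: "p (W x) = 0" for x by (metis diff_eq_eq add_cancel_left_right)
  have nV: "norm (V x) = norm (x - p x)" for x using nW[of "V x"] by (simp add: WV pV)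
  note entries = block_entries[OF p_proj _ cs_bop W V cs_range_proj cs_p WC VW WV pV]
  have pod: "p (od k) = 0" for k by (simp add: lin pp)
  have a_upper: "p (a (od k)) = cs (cs k)" for k
    by (simp only: cs_square off_diagonal_product pp)
  have a_corner: "a (od k) - p (a (od k)) = od k - od (ca k)" for k
    using off_diagonal_square[of k] by (simp add: lin pp algebra_simps)
  \<comment> \<open>On the complement \<open>b = 2 - T - a\<close>, and \<open>p\<close> annihilates
    the first two terms since \<open>T\<close> commutes with \<open>p\<close>.\<close>
  have b_upper: "p (b (od k)) = - cs (cs k)" for k
    unfolding b_on_q[OF pod]
    by (simp add: bopD[OF p_bop] a_upper T_p[symmetric] pp bopD(4)[OF T_bop])
  have b_corner: "b (od k) - p (b (od k)) = od k - od (cb k)" for k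
  proof -
    have od_b: "b (p k) - p (b (p k)) = - od k" for k by (rule off_diagonal_b)
    have sq: "b (b (p k)) - p (b (b (p k))) = b (p k) - p (b (p k))"
      by (rule compat_pair.off_diagonal_square[OF swap])
    \<comment> \<open>\<open>od\<close> is minus the off-diagonal entry of \<open>b\<close>, so it
      is expanded through \<open>b\<close> to make the square identity for \<open>b\<close>
      applicable.\<close>
    have "b (od k) - p (b (od k)) = (b (cb k) - p (b (cb k))) - (b (b (p k)) - p (b (b (p k))))"
    proof -
      have "od k = cb k - b (p k)" using od_b[of k] by (simp add: algebra_simps)
      then show ?thesis by (simp only: lin) (simp add: algebra_simps)
    qed
    also have "b (cb k) - p (b (cb k)) = - od (cb k)"
      using od_b[of "cb k"] by (simp only: pp)
    finally show ?thesis by (simp only: sq od_b) simp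
  qed
  have "p (a h) = ca (p h) + cs (V h) \<and> V (a h) = cs (p h) + (p (V h) - ca (V h))" for h
    using entries[OF a_bop, of 1 h] a_upper a_corner cs_ca by simp
  moreover have "p (b h) = cb (p h) - cs (V h) \<and> V (b h) = - cs (p h) + (p (V h) - cb (V h))" for h
    using entries[OF b_bop, of "-1" h] off_diagonal_b b_upper b_corner cs_cb by simp
  ultimately show ?thesis
    using that[OF W nW VW WV kk_unitaryI[OF p_proj V W nV VW WV pV pW] pW] by blast
qed

lemma rest_eq: "p h - (ca h + cb h) = p h - T (p h)"
  by (simp add: compress_b)

lemma rest_pos: "opos (\<lambda>h. p h - (ca h + cb h))"
proof -
  have "cinner h (p h - T (p h)) = cinner (p h) (p h - T (p h))" for h
    by (simp add: is_projD(4)[OF p_proj] lin pp T_p[symmetric])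
  moreover have "Im (cinner (p h) (p h - T (p h))) = 0 \<and> 0 \<le> Re (cinner (p h) (p h - T (p h)))" for h
    using T_le unfolding opos_def by blast
  moreover have "bop (\<lambda>h. p h - T (p h))" by (rule bop_minus[OF p_bop bop_comp[OF T_bop p_bop]])
  ultimately show ?thesis unfolding rest_eq opos_def by simp
qed

lemma strict_ca: assumes "vna M" shows "strict_in (corner M p) ca"
  using strict_in_cornerI[OF assms p_proj opos_ca ca_le] compress_inj compress_nofix by simp

text \<open>The operator is \<open>1 - T\<close> on \<open>pH\<close>, injective by
  \<open>one_minus_T_inj\<close>. At a fixed vector the positive operators \<open>ca\<close> and
  \<open>cb\<close> sum to zero, so \<open>ca\<close> vanishes there, against the injectivity of the
  compression.\<close>

lemma strict_rest: assumes "vna M" shows "strict_in (corner M p) (\<lambda>h. p h - (ca h + cb h))"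
proof (rule strict_in_cornerI[OF assms p_proj rest_pos])
  show "ole (\<lambda>h. p h - (ca h + cb h)) p"
  proof -
    have "(\<lambda>h. p h - (p h - (ca h + cb h))) = (\<lambda>h. ca h + cb h)" by (rule ext) simp
    then show ?thesis
      using opos_plus[OF opos_ca compat_pair.opos_ca[OF swap]] rest_pos p_bop
      by (simp only: ole_def) (simp add: opos_def)
  qed
  show "h = 0" if "p h = h" "p h - (ca h + cb h) = 0" for h
  proof (rule one_minus_T_inj[OF that(1)])
    have "p h - T (p h) = 0" using that(2) by (simp only: rest_eq)
    then show "T h = h" by (simp add: that(1))
  qed
  show "h = 0" if h: "p h = h" and fixed: "p h - (ca h + cb h) = h" for h
  proof (rule compress_inj[OF h])
    have "ca h + cb h = p h - h" by (rule eq_diff_eq[THEN iffD2]) (use fixed in \<open>simp only: diff_eq_eq add.commute\<close>)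
    then have "ca h + cb h = 0" by (simp only: h diff_self)
    then have "Re (cinner h (ca h)) + Re (cinner h (cb h)) = 0"
      by (metis cinner_add_right cinner_zero_right plus_complex.sel(1) zero_complex.sel(1))
    then have "Re (cinner h (ca h)) = 0"
      using oposD[OF opos_ca, of h] oposD[OF compat_pair.opos_ca[OF swap], of h] by linarith
    from opos_form_eq_0[OF opos_ca this] show "p (a h) = 0" by (simp add: h)
  qed
qed

end

section \<open>From the hypotheses to the compatible pair, and the theorem\<close>

lemma abs_compat_pair:
  assumes M: "vna M" and a: "a \<in> op_interval M id" and b: "b \<in> op_interval M id"
    and sa: "strict_in M a" and sb: "strict_in M b" and compat: "abs_compat a b"
    and p_def: "p = (\<lambda>h. h - rproj (jordan a b) h)"
    and T_def: "T = (\<lambda>h. a h + b h - a (b h) - b (a h))"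
  shows "compat_pair a b T p" "p \<in> M"
proof -
  have aM: "a \<in> M" and pa: "opos a" and qa: "opos (\<lambda>h. h - a h)"
    and bM: "b \<in> M" and pb: "opos b" and qb: "opos (\<lambda>h. h - b h)"
    using a b unfolding op_interval_def ole_zero_iff mem_Collect_eq by (simp_all add: ole_def)
  note T = abs_compat_modulus[OF T_def pa qa pb qb compat]
  let ?j = "jordan a b"
  note sa' = opos_selfadj[OF pa] and sb' = opos_selfadj[OF pb]
  note ba = selfadj_bop[OF sa'] and bb = selfadj_bop[OF sb'] and bT = selfadj_bop[OF opos_selfadj[OF T(1)]]
  note lin = bopD[OF ba] bopD[OF bb] bopD[OF bT]
  have jM: "?j \<in> M"
    unfolding jordan_def by (rule vna_scaleR[OF M vna_plus[OF M vna_comp[OF M aM bM] vna_comp[OF M bM aM]]])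
  have bj: "bop ?j"
    unfolding jordan_def by (rule bop_scaleR[OF bop_plus[OF bop_comp[OF ba bb] bop_comp[OF bb ba]]])
  have sj: "selfadj ?j"
    unfolding selfadj_def using bj
    by (simp add: jordan_def cinner_scaleR_left cinner_scaleR_right cinner_add_left cinner_add_right
        selfadjD[OF sa'] selfadjD[OF sb'] add.commute)
  have j: "2 *\<^sub>R ?j h = a h + b h - T h" for h by (simp add: jordan_def T_def)
  have Tj: "T (?j h) = ?j (T h)" for h
    by (simp add: jordan_def lin T(3,4)[symmetric])
  have jj: "?j (?j h) = ?j h - T (?j h)" for h
  proof -
    have "4 *\<^sub>R ?j (?j h) = 2 *\<^sub>R ?j (2 *\<^sub>R ?j h)" by (simp add: bopD[OF bj])
    also have "\<dots> = a (a h + b h - T h) + b (a h + b h - T h) - T (a h + b h - T h)"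
      unfolding j by (simp add: j)
    also have "\<dots> = 2 *\<^sub>R (a h + b h - T h) - 2 *\<^sub>R T (a h + b h - T h)"
    proof -
      have ba_h: "b (a h) = a h + b h - T h - a (b h)" by (simp add: T_def)
      have TT: "T (T h) = a (a h) - a (b h) - b (a h) + b (b h)"
        unfolding T(5) by (simp add: lin)
      show ?thesis unfolding lin T(3,4) TT ba_h by (simp add: scaleR_2 algebra_simps)
    qed
    also have "\<dots> = 4 *\<^sub>R (?j h - T (?j h))"
      unfolding j[symmetric] by (simp add: lin scaleR_diff_right)
    finally show ?thesis by simp
  qed
  have r: "is_proj (rproj ?j)" by (rule rproj_spec(1)[OF bj])
  have pp: "is_proj p" unfolding p_def by (rule is_proj_compl[OF r])
  show "p \<in> M" unfolding p_def by (rule vna_minus[OF M vna_id[OF M] vna_rproj[OF M jM sj]])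
  show "compat_pair a b T p"
  proof
    fix h
    show "T (p h) = p (T h)" using rproj_commute[OF sj bT Tj[symmetric]] by (simp add: p_def lin)
    show "a (b h) + b (a h) = a h + b h - T h" by (simp add: T_def)
    show "a h + b h = T h" if "p h = h"
    proof -
      have "?j h = 0" using that rproj_selfadj_eq_0_iff[OF sj, of h] by (simp add: p_def)
      then show ?thesis using j[of h] by simp
    qed
    show "a h + b h = 2 *\<^sub>R h - T h" if "p h = 0"
    proof -
      \<comment> \<open>\<open>j^2 = (1 - T) j\<close> says that \<open>j\<close> and
        \<open>1 - T\<close> agree on the range of \<open>j\<close>, hence on its closure, the
        complement of \<open>pH\<close>.\<close>
      have "?j (rproj ?j h) = rproj ?j h - T (rproj ?j h)"
        by (rule bop_eq_on_closure_range[OF bj bj bop_minus[OF bop_id bT] jj])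
      moreover have "rproj ?j h = h" using that by (simp add: p_def)
      ultimately have "a h + b h - T h = 2 *\<^sub>R (h - T h)" using j[of h] by simp
      then show ?thesis by (simp add: scaleR_2 algebra_simps)
    qed
  qed (fact pa qa pb qb bT T(2) pp T(3,4)[symmetric] strict_in_kernel[OF M a sa]
      strict_in_fixed[OF M a sa] strict_in_kernel[OF M b sb] strict_in_fixed[OF M b sb])+
qed

theorem theorem1p2:
  fixes M :: "('h::chilbert \<Rightarrow> 'h) set" and a b :: "'h \<Rightarrow> 'h"
  assumes "vna M"
    and "a \<in> op_interval M id" and "b \<in> op_interval M id"
    and "strict_in M a" and "strict_in M b"
    and "abs_compat a b"
  defines "p \<equiv> (\<lambda>h. h - rproj (jordan a b) h)"
  shows "(\<exists>V. clinear_map V \<and> bij_betw V (range p) (range (\<lambda>h. h - p h))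
            \<and> (\<forall>x\<in>range p. norm (V x) = norm x))
       \<and> (\<exists>U. kk_unitary p U)
       \<and> (\<exists>a1 b1 U.
            a1 \<in> op_interval M p \<and> b1 \<in> op_interval M p
          \<and> strict_in (corner M p) a1 \<and> strict_in (corner M p) b1
          \<and> a1 \<circ> b1 = b1 \<circ> a1
          \<and> ole (\<lambda>h. a1 h + b1 h) p
          \<and> strict_in (corner M p) (\<lambda>h. p h - (a1 h + b1 h))
          \<and> kk_unitary p U
          \<and> (\<forall>h. a h = inv U (mat2 a1 (osqrt (a1 \<circ> b1)) (osqrt (a1 \<circ> b1))
                                   (\<lambda>k. p k - a1 k) (U h)))
          \<and> (\<forall>h. b h = inv U (mat2 b1 (\<lambda>k. - osqrt (a1 \<circ> b1) k) (\<lambda>k. - osqrt (a1 \<circ> b1) k)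
                                   (\<lambda>k. p k - b1 k) (U h))))"
proof -
  note M = assms(1)
  interpret compat_pair a b "\<lambda>h. a h + b h - a (b h) - b (a h)" p
    by (rule abs_compat_pair(1)[OF assms(1-6)]) (simp_all add: p_def)
  have pM: "p \<in> M" by (rule abs_compat_pair(2)[OF assms(1-6)]) (simp_all add: p_def)
  have aM: "a \<in> M" and bM: "b \<in> M" using assms(2,3) by (auto simp: op_interval_def)
  obtain W V where W: "bop W" and nW: "\<And>x. norm (W x) = norm (p x)" and VW: "\<And>x. V (W x) = p x"
    and WV: "\<And>x. W (V x) = x - p x" and U: "kk_unitary p (\<lambda>h. (p h, V h))"
    and pW: "\<And>x. p (W x) = 0"
    and blocks: "\<And>h. p (a h) = ca (p h) + cs (V h)" "\<And>h. V (a h) = cs (p h) + (p (V h) - ca (V h))"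
    "\<And>h. p (b h) = cb (p h) - cs (V h)" "\<And>h. V (b h) = - cs (p h) + (p (V h) - cb (V h))"
    by (rule block_decomposition) blast
  let ?U = "\<lambda>h. (p h, V h)"
  have inj: "inj ?U" using U by (auto simp: kk_unitary_def bij_betw_def)
  have pV: "V h \<in> range p" for h
    using U rangeI[of ?U h] by (simp add: kk_unitary_def bij_betw_def)
  have "bij_betw W (range p) (range (\<lambda>h. h - p h))"
  proof (rule bij_betwI[where g = V])
    show "W \<in> range p \<rightarrow> range (\<lambda>h. h - p h)"
      by (auto simp: pW intro!: range_eqI[where x = "W _"])
  qed (use pV in \<open>auto simp: VW WV pp lin\<close>)
  moreover have "\<forall>x\<in>range p. norm (W x) = norm x" by (auto simp: nW pp)
  moreover have "clinear_map W" using W by (rule bop_clinear)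
  moreover have "ca \<in> op_interval M p"
    using vna_comp[OF M pM vna_comp[OF M aM pM]] opos_ca ca_le
    by (simp add: op_interval_def ole_zero_iff)
  moreover have "cb \<in> op_interval M p"
    using vna_comp[OF M pM vna_comp[OF M bM pM]] compat_pair.opos_ca[OF swap] compat_pair.ca_le[OF swap]
    by (simp add: op_interval_def ole_zero_iff)
  moreover have "ca \<circ> cb = cb \<circ> ca" by (auto simp: pp compress_commute)
  moreover have "ole (\<lambda>h. ca h + cb h) p"
    using rest_pos bop_plus[OF bop_ca bop_cb] p_bop by (simp only: ole_def)
  \<comment> \<open>The block formulas say that the matrix sends \<open>?U h\<close> to
    \<open>?U (a h)\<close>; injectivity of \<open>?U\<close> then recovers
    \<open>a h\<close>.\<close>
  moreover have "\<forall>h. a h = inv ?U (mat2 ca (osqrt (ca \<circ> cb)) (osqrt (ca \<circ> cb)) (\<lambda>k. p k - ca k) (?U h))"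
  proof
    fix h
    have "mat2 ca cs cs (\<lambda>k. p k - ca k) (?U h) = ?U (a h)"
      unfolding blocks(1,2)[of h] by (simp add: mat2_def)
    then show "a h = inv ?U (mat2 ca (osqrt (ca \<circ> cb)) (osqrt (ca \<circ> cb)) (\<lambda>k. p k - ca k) (?U h))"
      by (simp only: cs_def[symmetric] inv_f_f[OF inj])
  qed
  moreover have "\<forall>h. b h = inv ?U (mat2 cb (\<lambda>k. - osqrt (ca \<circ> cb) k) (\<lambda>k. - osqrt (ca \<circ> cb) k)
      (\<lambda>k. p k - cb k) (?U h))"
  proof
    fix h
    have "mat2 cb (\<lambda>k. - cs k) (\<lambda>k. - cs k) (\<lambda>k. p k - cb k) (?U h) = ?U (b h)"
      unfolding blocks(3,4)[of h] by (simp add: mat2_def)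
    then show "b h = inv ?U (mat2 cb (\<lambda>k. - osqrt (ca \<circ> cb) k) (\<lambda>k. - osqrt (ca \<circ> cb) k)
        (\<lambda>k. p k - cb k) (?U h))"
      by (simp only: cs_def[symmetric] inv_f_f[OF inj])
  qed
  ultimately show ?thesis
    using U strict_ca[OF M] compat_pair.strict_ca[OF swap M] strict_rest[OF M] by blast
qed

end
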